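(* Suppose $l<p$. Then every strict equivalence class of surjective characters $U_1\to\mathbb{Z}/p^2\mathbb{Z}$ of type $\langle l,m\rangle$ contains exactly one character in reduced form, i.e. of standard expansion $$x_l\,\mathfrak{Z}_l+\sum_{\substack{m-l\le j\le m\\ p\nmid j}} b_j\cdot p\,\mathfrak{Z}_j,$$ with $x_l,b_j\in\{0,\dots,p-1\}$, $x_l\ne0$, and $b_m\ne0$ if $p\nmid m$. Equivalently, two distinct reduced forms of type $\langle l,m\rangle$ are never strictly equivalent.
   Context: Let $p$ be a prime, $K=\mathbb{F}_p((t))$, $U_1=1+t\mathbb{F}_p[[t]]$ the group of principal units, and $U_j=1+t^j\mathbb{F}_p[[t]]$ for $j\ge1$; $U_1$ carries the $t$-adic topology. The Nottingham group $\mathcal{N}$ over $\mathbb{F}_p$ is the set of power series $u(t)=t(1+c_1t+c_2t^2+\cdots)$ with $c_i\in\mathbb{F}_p$, a group under composition. A character is a continuous homomorphism $\chi:U_1\to\mathbb{Z}/p^2\mathbb{Z}$ (discrete topology on the target). $\mathcal{N}$ acts on characters by ${}_u\chi(f(t))=\chi(f(u(t)))$ for $f\in U_1$. Two characters $\chi,\psi$ are strictly equivalent, $\chi\simeq\psi$, if there is $u\in\mathcal{N}$ with $\psi={}_u\chi$ and $\chi(u(t)/t)=0$. A surjective character $\chi$ has type (break sequence) $\langle l,m\rangle$ where $l$ is the largest integer $b$ with $\chi(U_b)\not\subset p\mathbb{Z}/p^2\mathbb{Z}$ and $m$ is the largest integer $b$ with $\chi(U_b)\neq 0$. Put $E_j=1+t^j$.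 The elements $E_j$ with $p\nmid j$ form a topological $\mathbb{Z}_p$-basis of $U_1$; for $p\nmid j$, $\mathfrak{Z}_j$ denotes the character with $\mathfrak{Z}_j(E_i)=\delta_{ij}$ for all $i$ with $p\nmid i$. Every character of type $\langle l,m\rangle$ can be written uniquely in standard expansion $\chi=\sum_{1\le i\le l,\,p\nmid i}x_i\mathfrak{Z}_i+\sum_{1\le j\le m,\,p\nmid j}a_j\cdot p\,\mathfrak{Z}_j$ with $x_i,a_j\in\{0,\dots,p-1\}$. *)

theory Defs
  imports "HOL-Computational_Algebra.Formal_Power_Series"
begin

text \<open>The coefficient field F_p is modelled by a finite field type 'a of prime
cardinality p = CARD('a). Power series over F_p are 'a fps, with the t-adic
metric topology of the library. Z/p^2 Z is modelled by the integers in
{0..<p^2}, addition taken mod p^2 (discrete topology of int).\<close>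

definition U1 :: "'a::field fps set" where
  "U1 = {f. fps_nth f 0 = 1}"

definition Uj :: "nat \<Rightarrow> 'a::field fps set" where
  "Uj j = {f. fps_nth f 0 = 1 \<and> (\<forall>i. 0 < i \<and> i < j \<longrightarrow> fps_nth f i = 0)}"

definition Ej :: "nat \<Rightarrow> 'a::field fps" where
  "Ej j = 1 + fps_X ^ j"

definition Nottingham :: "'a::field fps set" where
  "Nottingham = {u. fps_nth u 0 = 0 \<and> fps_nth u 1 = 1}"

definition is_char :: "nat \<Rightarrow> ('a::field fps \<Rightarrow> int) \<Rightarrow> bool" where
  "is_char p \<chi> \<longleftrightarrow>
     (\<forall>f\<in>U1. \<chi> f \<in> {0..<int p ^ 2}) \<and>
     (\<forall>f\<in>U1. \<forall>g\<in>U1. \<chi> (f * g) = (\<chi> f + \<chi> g) mod (int p ^ 2)) \<and>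
     continuous_on U1 \<chi>"

definition surj_char :: "nat \<Rightarrow> ('a::field fps \<Rightarrow> int) \<Rightarrow> bool" where
  "surj_char p \<chi> \<longleftrightarrow> is_char p \<chi> \<and> \<chi> ` U1 = {0..<int p ^ 2}"

definition char_type :: "nat \<Rightarrow> ('a::field fps \<Rightarrow> int) \<Rightarrow> nat \<Rightarrow> nat \<Rightarrow> bool" where
  "char_type p \<chi> l m \<longleftrightarrow>
     1 \<le> l \<and> (\<exists>f\<in>Uj l. \<not> int p dvd \<chi> f) \<and> (\<forall>b>l. \<forall>f\<in>Uj b. int p dvd \<chi> f) \<and>
     1 \<le> m \<and> (\<exists>f\<in>Uj m. \<chi> f \<noteq> 0) \<and> (\<forall>b>m. \<forall>f\<in>Uj b. \<chi> f = 0)"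

definition strict_equiv :: "('a::field fps \<Rightarrow> int) \<Rightarrow> ('a fps \<Rightarrow> int) \<Rightarrow> bool" where
  "strict_equiv \<chi> \<psi> \<longleftrightarrow>
     (\<exists>u\<in>Nottingham. (\<forall>f\<in>U1. \<psi> f = \<chi> (fps_compose f u)) \<and> \<chi> (fps_shift 1 u) = 0)"

text \<open>The dual basis character Z_j (p does not divide j): Z_j(E_i) = delta_ij for p not dividing i;
normalised to 0 outside U_1 so that it is uniquely determined.\<close>
definition Zfrak :: "nat \<Rightarrow> nat \<Rightarrow> 'a::field fps \<Rightarrow> int" where
  "Zfrak p j = (THE \<chi>. is_char p \<chi> \<and> (\<forall>f. f \<notin> U1 \<longrightarrow> \<chi> f = 0) \<and>
      (\<forall>i. 1 \<le> i \<and> \<not> p dvd i \<longrightarrow> \<chi> (Ej i) = (if i = j then 1 else 0)))"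

definition reduced_form :: "nat \<Rightarrow> nat \<Rightarrow> nat \<Rightarrow> ('a::field fps \<Rightarrow> int) \<Rightarrow> bool" where
  "reduced_form p l m \<psi> \<longleftrightarrow>
     (\<exists>(x::int) (b::nat \<Rightarrow> int).
        x \<in> {1..<int p} \<and> (\<forall>j. b j \<in> {0..<int p}) \<and> (\<not> p dvd m \<longrightarrow> b m \<noteq> 0) \<and>
        (\<forall>f\<in>U1. \<psi> f =
           (x * Zfrak p l f +
            (\<Sum>j\<in>{j. m - l \<le> j \<and> j \<le> m \<and> \<not> p dvd j}. b j * int p * Zfrak p j f))
           mod (int p ^ 2)))"

end

theory Submission
  imports Defs "HOL-Number_Theory.Residues"
begin

text \<open>
  If \<open>u = t (1 + c t\<^sup>k + \<dots>)\<close>, then \<open>E\<^sub>j(u) = E\<^sub>j (1 + j c t\<^sup>j\<^sup>+\<^sup>k + \<dots>)\<close>, and a character is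
  determined by its values at the \<open>E\<^sub>j\<close> with \<open>p\<close> not dividing \<open>j\<close>.

  Existence: for \<open>j\<close> descending from \<open>l - 1\<close>, a substitution with \<open>k = l - j\<close> makes \<open>\<chi>(E\<^sub>j)\<close>
  divisible by \<open>p\<close> without changing \<open>\<chi>(E\<^sub>i)\<close> modulo \<open>p\<close> for \<open>i > j\<close>. Then, for \<open>j\<close> descending from
  \<open>m - l - 1\<close>, a substitution with \<open>k = m - j > l\<close> removes the \<open>p\<close>-part of \<open>\<chi>(E\<^sub>j)\<close>, leaving \<open>\<chi>\<close>
  modulo \<open>p\<close> and all \<open>\<chi>(E\<^sub>i)\<close> with \<open>i > j\<close> alone. The higher terms of \<open>u\<close> are used to achieve
  \<open>\<chi>(u/t) = 0\<close>.

  Uniqueness: if \<open>u\<close> carries a reduced form to a reduced form, then comparing the values modulo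
  \<open>p\<close> at \<open>E\<^sub>i\<close>, \<open>i < l < p\<close>, gives \<open>k \<ge> l\<close>, and \<open>\<chi>(u/t) = 0\<close> excludes \<open>k = l\<close>. Now \<open>E\<^sub>j(u)/E\<^sub>j\<close> lies
  in \<open>U\<^sub>m\<^sub>+\<^sub>1\<close> for all \<open>j \<ge> m - l\<close>, so no coefficient in the window changes.
\<close>

subsection \<open>The filtration of the principal units\<close>

lemma U1_eq_Uj: "U1 = Uj 1"
  by (auto simp: U1_def Uj_def)

lemma Uj_subset_U1: "Uj n \<subseteq> U1"
  by (auto simp: U1_def Uj_def)

lemma Uj_antimono: "m \<le> n \<Longrightarrow> Uj n \<subseteq> Uj m"
  by (auto simp: Uj_def)

lemma UjD_U1: "f \<in> Uj n \<Longrightarrow> f \<in> U1"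
  using Uj_subset_U1 by blast

lemma Uj_SucI: "f \<in> Uj n \<Longrightarrow> 1 \<le> n \<Longrightarrow> fps_nth f n = 0 \<Longrightarrow> f \<in> Uj (Suc n)"
  by (auto simp: Uj_def less_Suc_eq)

lemma one_plus_X_power_mult_in_Uj: "1 \<le> n \<Longrightarrow> 1 + fps_X ^ n * q \<in> Uj n"
  by (auto simp: Uj_def fps_X_power_mult_nth)

lemma UjE:
  assumes "f \<in> Uj n" "1 \<le> n"
  obtains q where "f = 1 + fps_X ^ n * q" "fps_nth q 0 = fps_nth f n"
proof
  show "f = 1 + fps_X ^ n * fps_shift n f"
    using assms by (auto simp: fps_eq_iff fps_X_power_mult_nth Uj_def)
qed simp

lemma one_in_Uj [simp]: "1 \<in> Uj n" "1 \<in> U1"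
  by (auto simp: Uj_def U1_def)

lemma U1_mult [simp, intro]: "f \<in> U1 \<Longrightarrow> g \<in> U1 \<Longrightarrow> f * g \<in> U1"
  by (simp add: U1_def)

lemma U1_inverse [simp, intro]: "f \<in> U1 \<Longrightarrow> inverse f \<in> U1"
  by (simp add: U1_def)

lemma U1_power [simp, intro]: "f \<in> U1 \<Longrightarrow> f ^ k \<in> U1"
  by (simp add: U1_def fps_power_zeroth)

lemma U1_mult_inverse: "f \<in> U1 \<Longrightarrow> f * inverse f = 1"
  by (simp add: U1_def inverse_mult_eq_1')

text \<open>In (1 + X^n q)(1 + X^n r) the cross term has order at least 2n > n. So the coefficient
  at \<open>n\<close> identifies \<open>Uj n\<close> modulo \<open>Uj (Suc n)\<close> with the
  additive group of the field.\<close>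

lemma Uj_mult: "f \<in> Uj n \<Longrightarrow> g \<in> Uj n \<Longrightarrow> 1 \<le> n \<Longrightarrow> f * g \<in> Uj n"
  and Uj_mult_nth: "f \<in> Uj n \<Longrightarrow> g \<in> Uj n \<Longrightarrow> 1 \<le> n \<Longrightarrow>
    fps_nth (f * g) n = fps_nth f n + fps_nth g n"
proof -
  assume fg: "f \<in> Uj n" "g \<in> Uj n" and n: "1 \<le> n"
  obtain q where q: "f = 1 + fps_X ^ n * q" "fps_nth q 0 = fps_nth f n"
    using UjE[OF fg(1) n] .
  obtain r where r: "g = 1 + fps_X ^ n * r" "fps_nth r 0 = fps_nth g n"
    using UjE[OF fg(2) n] .
  have eq: "f * g = 1 + fps_X ^ n * (q + r + fps_X ^ n * q * r)"
    by (simp add: q(1) r(1) algebra_simps)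
  show "f * g \<in> Uj n"
    unfolding eq by (rule one_plus_X_power_mult_in_Uj[OF n])
  show "fps_nth (f * g) n = fps_nth f n + fps_nth g n"
    unfolding eq using n by (simp add: fps_X_power_mult_nth q(2) r(2) mult.assoc)
qed

lemma Uj_power:
  assumes "f \<in> Uj n" "1 \<le> n"
  shows "f ^ k \<in> Uj n \<and> fps_nth (f ^ k) n = of_nat k * fps_nth f n"
proof (induction k)
  case 0
  then show ?case using assms by simp
next
  case (Suc k)
  then show ?case
    using Uj_mult[of f n "f ^ k"] Uj_mult_nth[of f n "f ^ k"] assms by (simp add: distrib_right)
qed

text \<open>Writing f = g + X^n q gives f/g = 1 + X^n q/g, and 1/g has constant term 1. Agreement of
  coefficients thus turns into membership in the filtration, which characters can see.\<close>

lemma quotient_in_Uj: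
  assumes "f \<in> U1" "g \<in> U1" "1 \<le> n" "\<And>i. i < n \<Longrightarrow> fps_nth f i = fps_nth g i"
  shows "f * inverse g \<in> Uj n"
    and "fps_nth (f * inverse g) n = fps_nth f n - fps_nth g n"
proof -
  define q where "q = fps_shift n (f - g)"
  have fg: "f = g + fps_X ^ n * q"
    using assms(4) by (auto simp: fps_eq_iff fps_X_power_mult_nth q_def)
  have eq: "f * inverse g = 1 + fps_X ^ n * (q * inverse g)"
    by (subst fg) (simp add: algebra_simps U1_mult_inverse[OF assms(2)])
  show "f * inverse g \<in> Uj n"
    unfolding eq by (rule one_plus_X_power_mult_in_Uj[OF assms(3)])
  show "fps_nth (f * inverse g) n = fps_nth f n - fps_nth g n"
    unfolding eq using assms(2,3)
    by (simp add: fps_X_power_mult_nth q_def U1_def)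
qed

lemma Uj_quotient_SucI:
  assumes "f \<in> Uj n" "g \<in> Uj n" "1 \<le> n" "fps_nth f n = fps_nth g n"
  shows "f * inverse g \<in> Uj (Suc n)"
proof (rule quotient_in_Uj)
  show "fps_nth f i = fps_nth g i" if "i < Suc n" for i
    using assms that by (cases "i = 0"; cases "i = n") (auto simp: Uj_def)
qed (use assms in \<open>auto simp: Uj_def U1_def\<close>)

lemma Ej_in_Uj: "1 \<le> j \<Longrightarrow> Ej j \<in> (Uj j :: 'a::field fps set)"
  and Ej_in_U1: "1 \<le> j \<Longrightarrow> Ej j \<in> (U1 :: 'a fps set)"
  and Ej_nth_self: "1 \<le> j \<Longrightarrow> fps_nth (Ej j :: 'a fps) j = 1"
  by (auto simp: Uj_def U1_def Ej_def)

lemma Ej_power_in_Uj: "1 \<le> j \<Longrightarrow> Ej j ^ c \<in> (Uj j :: 'a::field fps set)"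
  and Ej_power_nth_self: "1 \<le> j \<Longrightarrow> fps_nth (Ej j ^ c :: 'a fps) j = of_nat c"
  using Uj_power[OF Ej_in_Uj[of j], of c, where 'a = 'a] Ej_nth_self[of j, where 'a = 'a] by auto

subsection \<open>Substitution of Nottingham elements\<close>

lemma fps_shift_Nottingham: "u \<in> Nottingham \<Longrightarrow> fps_shift 1 u \<in> U1"
  by (simp add: Nottingham_def U1_def)

lemma Nottingham_eq: "u \<in> Nottingham \<Longrightarrow> u = fps_X * fps_shift 1 u"
  by (auto simp: fps_eq_iff Nottingham_def)

lemma X_mult_in_Nottingham: "g \<in> U1 \<Longrightarrow> fps_X * g \<in> Nottingham"
  by (simp add: Nottingham_def U1_def)

lemma Nottingham_nth_0: "u \<in> Nottingham \<Longrightarrow> fps_nth u 0 = 0"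
  by (simp add: Nottingham_def)

text \<open>Since u = X g with g(0) = 1, composition turns X^n into X^n g^n. Substitution therefore
  acts trivially on each quotient of \<open>Uj n\<close> by \<open>Uj (Suc n)\<close>.\<close>

lemma Uj_compose:
  fixes f :: "'a::field fps"
  assumes "f \<in> Uj n" "1 \<le> n" "u \<in> Nottingham"
  shows "f oo u \<in> Uj n" and "fps_nth (f oo u) n = fps_nth f n"
proof -
  define g where "g = fps_shift 1 u"
  have u: "u = fps_X * g" and g: "fps_nth g 0 = 1" and u0: "fps_nth u 0 = 0"
    using assms(3) Nottingham_eq[of u] by (auto simp: g_def Nottingham_def)
  obtain q where q: "f = 1 + fps_X ^ n * q" "fps_nth q 0 = fps_nth f n"
    using UjE[OF assms(1,2)] .
  have "f oo u = 1 + u ^ n * (q oo u)"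
    unfolding q(1) using u0
    by (simp add: fps_compose_add_distrib fps_compose_mult_distrib flip: fps_compose_power)
  also have "\<dots> = 1 + fps_X ^ n * (g ^ n * (q oo u))"
    by (subst u) (simp add: power_mult_distrib mult.assoc)
  finally have eq: "f oo u = 1 + fps_X ^ n * (g ^ n * (q oo u))" .
  show "f oo u \<in> Uj n"
    unfolding eq by (rule one_plus_X_power_mult_in_Uj[OF assms(2)])
  show "fps_nth (f oo u) n = fps_nth f n"
    unfolding eq using assms(2) by (simp add: fps_X_power_mult_nth fps_power_zeroth g q(2))
qed

lemma U1_compose: "f \<in> U1 \<Longrightarrow> f oo u \<in> U1"
  by (simp add: U1_def)

text \<open>With g = u/X one has E_j(u) = 1 + X^j g^j and g^j = 1 + j c X^k + ..., where c is the
  coefficient of g at \<open>k\<close>. The factor \<open>of_nat j\<close> is why adjustments are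
  made only at \<open>j\<close> prime to \<open>p\<close>.\<close>

lemma Ej_compose:
  fixes u :: "'a::field fps"
  assumes u: "u \<in> Nottingham" and g: "fps_shift 1 u \<in> Uj k" and k: "1 \<le> k" and j: "1 \<le> j"
  obtains h where "h \<in> Uj (j + k)" "Ej j oo u = Ej j * h"
    "fps_nth h (j + k) = of_nat j * fps_nth (fps_shift 1 u) k"
proof
  define g where "g = fps_shift 1 u"
  have gU: "g \<in> Uj k" and gj: "g ^ j \<in> Uj k" "fps_nth (g ^ j) k = of_nat j * fps_nth g k"
    using Uj_power[OF g k, of j] g by (auto simp: g_def)
  have "Ej j oo u = 1 + u ^ j"
    using Nottingham_nth_0[OF u]
    by (simp add: Ej_def fps_compose_add_distrib flip: fps_compose_power)
  also have "\<dots> = 1 + fps_X ^ j * g ^ j"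
    by (subst Nottingham_eq[OF u]) (simp add: power_mult_distrib g_def)
  finally have eq: "Ej j oo u = 1 + fps_X ^ j * g ^ j" .
  have E1: "Ej j \<in> (U1 :: 'a fps set)"
    using Ej_in_U1[OF j] .
  have "fps_nth (g ^ j) i = (if i = 0 then 1 else 0)" if "i < k" for i
    using gj(1) that by (auto simp: Uj_def)
  hence agree: "fps_nth (Ej j oo u) i = fps_nth (Ej j) i" if "i < j + k" for i
    unfolding eq using that by (auto simp: Ej_def fps_X_power_mult_nth)
  let ?h = "(Ej j oo u) * inverse (Ej j)"
  show "?h \<in> Uj (j + k)"
    using quotient_in_Uj(1)[OF U1_compose[OF E1] E1 _ agree, where n = "j + k"] j by simp
  have "fps_nth ?h (j + k) = fps_nth (Ej j oo u) (j + k) - fps_nth (Ej j :: 'a fps) (j + k)"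
    using quotient_in_Uj(2)[OF U1_compose[OF E1] E1 _ agree, where n = "j + k"] j by simp
  also have "\<dots> = of_nat j * fps_nth g k"
    unfolding eq using j k gj(2) by (simp add: Ej_def fps_X_power_mult_nth)
  finally show "fps_nth ?h (j + k) = of_nat j * fps_nth (fps_shift 1 u) k"
    by (simp add: g_def)
  show "Ej j oo u = Ej j * ?h"
    using U1_mult_inverse[OF E1] by (simp add: mult.left_commute)
qed

subsection \<open>Characters\<close>

lemma is_char_range: "is_char p \<chi> \<Longrightarrow> f \<in> U1 \<Longrightarrow> \<chi> f \<in> {0..<int p ^ 2}"
  by (auto simp: is_char_def)

lemma is_char_eqI:
  assumes "is_char p \<chi>" "is_char p \<psi>" "f \<in> U1" "g \<in> U1" "[\<chi> f = \<psi> g] (mod int p ^ 2)"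
  shows "\<chi> f = \<psi> g"
  using is_char_range[OF assms(1,3)] is_char_range[OF assms(2,4)] assms(5)
  by (auto intro: cong_less_imp_eq_int)

lemma is_char_eq_0I:
  assumes "is_char p \<chi>" "f \<in> U1" "[\<chi> f = 0] (mod int p ^ 2)"
  shows "\<chi> f = 0"
  using is_char_range[OF assms(1,2)] assms(3) by (auto simp: cong_def)

lemma is_char_mult:
  "is_char p \<chi> \<Longrightarrow> f \<in> U1 \<Longrightarrow> g \<in> U1 \<Longrightarrow> [\<chi> (f * g) = \<chi> f + \<chi> g] (mod int p ^ 2)"
  by (auto simp: is_char_def)

lemma is_char_one: 
  assumes "is_char p \<chi>"
  shows "\<chi> 1 = 0"
proof (rule is_char_eq_0I[OF assms])
  have "[\<chi> 1 + 0 = \<chi> 1 + \<chi> 1] (mod int p ^ 2)"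
    using is_char_mult[OF assms, of 1 1] by simp
  then show "[\<chi> 1 = 0] (mod int p ^ 2)"
    by (metis cong_add_lcancel cong_sym)
qed simp

lemma is_char_power:
  assumes "is_char p \<chi>" "f \<in> U1"
  shows "[\<chi> (f ^ k) = int k * \<chi> f] (mod int p ^ 2)"
proof (induction k)
  case 0
  then show ?case using is_char_one[OF assms(1)] by simp
next
  case (Suc k)
  have "[\<chi> (f ^ Suc k) = \<chi> f + \<chi> (f ^ k)] (mod int p ^ 2)"
    using is_char_mult[OF assms(1) assms(2) U1_power[OF assms(2), of k]] by simp
  also have "[\<chi> f + \<chi> (f ^ k) = \<chi> f + int k * \<chi> f] (mod int p ^ 2)"
    by (intro cong_add Suc) simp
  finally show ?case by (simp add: algebra_simps)
qed

lemma is_char_quotient: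
  assumes "is_char p \<chi>" "f \<in> U1" "g \<in> U1"
  shows "[\<chi> f = \<chi> g + \<chi> (f * inverse g)] (mod int p ^ 2)"
proof -
  have "g * (f * inverse g) = f"
    using U1_mult_inverse[OF assms(3)] by (simp add: mult.left_commute)
  then show ?thesis
    using is_char_mult[OF assms(1,3) U1_mult[OF assms(2) U1_inverse[OF assms(3)]]] by (simp only:)
qed

text \<open>The target is discrete, so the preimage of 0 is open; it contains 1 and hence a t-adic
  ball around 1.\<close>

lemma is_char_conductor:
  fixes \<chi> :: "'a::field fps \<Rightarrow> int"
  assumes "is_char p \<chi>"
  obtains N where "1 \<le> N" "\<And>f. f \<in> Uj N \<Longrightarrow> \<chi> f = 0"
proof -
  have "continuous_on U1 \<chi>"
    using assms by (simp add: is_char_def)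
  then have "\<exists>A. open A \<and> A \<inter> U1 = \<chi> -` {0} \<inter> U1"
    unfolding continuous_on_open_invariant by (simp add: open_discrete)
  then obtain A where A: "open A" "A \<inter> U1 = \<chi> -` {0} \<inter> U1"
    by (elim exE conjE)
  have "1 \<in> \<chi> -` {0} \<inter> U1"
    using is_char_one[OF assms] by simp
  then have "1 \<in> A"
    unfolding A(2)[symmetric] by simp
  then obtain n where n: "{G. fps_cutoff n G = fps_cutoff n 1} \<subseteq> A"
    using A(1)[unfolded open_fps_iff] by (elim ballE exE) auto
  \<comment> \<open>\<open>Suc n\<close> ensures \<open>1 \<le> N\<close> even when the radius
    \<open>n\<close> is 0.\<close>
  show ?thesis
  proof (rule that[of "Suc n"])
    fix f :: "'a fps"
    assume f: "f \<in> Uj (Suc n)"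
    then have "fps_cutoff n f = fps_cutoff n 1"
      by (auto simp: fps_cutoff_eq_fps_cutoff_iff Uj_def)
    then have "f \<in> A \<inter> U1"
      using n UjD_U1[OF f] by auto
    then show "\<chi> f = 0"
      unfolding A(2) by simp
  qed simp
qed

text \<open>Continuity comes for free: a homomorphism that kills \<open>Uj N\<close> depends only on
  the coefficients below \<open>N\<close>, so every preimage is a union of balls.\<close>

lemma is_charI:
  fixes \<chi> :: "'a::field fps \<Rightarrow> int"
  assumes range: "\<And>f. f \<in> U1 \<Longrightarrow> \<chi> f \<in> {0..<int p ^ 2}"
    and mult: "\<And>f g. f \<in> U1 \<Longrightarrow> g \<in> U1 \<Longrightarrow> [\<chi> (f * g) = \<chi> f + \<chi> g] (mod int p ^ 2)"
    and kills: "\<And>f. f \<in> Uj N \<Longrightarrow> \<chi> f = 0" and N: "1 \<le> N"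
  shows "is_char p \<chi>"
proof -
  have mult': "\<chi> (f * g) = (\<chi> f + \<chi> g) mod int p ^ 2" if "f \<in> U1" "g \<in> U1" for f g
    using mult[OF that] range[of "f * g"] that by (auto simp: cong_def)
  have eq: "\<chi> f = \<chi> g" if "f \<in> U1" "g \<in> U1" "fps_cutoff N f = fps_cutoff N g" for f g
  proof -
    have "f * inverse g \<in> Uj N"
      using quotient_in_Uj(1)[of f g N] that N by (auto simp: fps_cutoff_eq_fps_cutoff_iff)
    then have "\<chi> (f * inverse g * g) = \<chi> g"
      using mult'[of "f * inverse g" g] that range[of g] kills by auto
    then show ?thesis
      using U1_mult_inverse[OF that(2)] by (simp add: mult.assoc mult.commute[of "inverse g"])
  qed
  have "continuous_on U1 \<chi>"
    unfolding continuous_on_open_invariant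
  proof (intro allI impI exI conjI)
    fix B :: "int set"
    let ?A = "\<Union>F\<in>{F\<in>U1. \<chi> F \<in> B}. {G. fps_cutoff N G = fps_cutoff N F}"
    show "open ?A"
      by (intro open_UN ballI open_fps_cutoff)
    show "?A \<inter> U1 = \<chi> -` B \<inter> U1"
      using eq by auto
  qed
  then show ?thesis
    using range mult' by (simp add: is_char_def)
qed

lemma is_char_add:
  assumes "is_char p \<chi>" "is_char p \<psi>"
  shows "is_char p (\<lambda>f. (\<chi> f + \<psi> f) mod int p ^ 2)"
proof -
  obtain N where N: "1 \<le> N" "\<And>f. f \<in> Uj N \<Longrightarrow> \<chi> f = 0"
    using is_char_conductor[OF assms(1)] by metis
  obtain M where M: "1 \<le> M" "\<And>f. f \<in> Uj M \<Longrightarrow> \<psi> f = 0"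
    using is_char_conductor[OF assms(2)] by metis
  show ?thesis
  proof (rule is_charI[where N = "max M N"])
    fix f :: "'a fps"
    assume "f \<in> U1"
    \<comment> \<open>The existing value of \<chi> shows that the range
      \<open>{0..<int p ^ 2}\<close> is nonempty, hence that the modulus is positive.\<close>
    then have "0 < int p ^ 2"
      using is_char_range[OF assms(1), of f] by (metis atLeastLessThan_iff le_less_trans)
    then show "(\<chi> f + \<psi> f) mod int p ^ 2 \<in> {0..<int p ^ 2}"
      by simp
  next
    fix f g :: "'a fps"
    assume fg: "f \<in> U1" "g \<in> U1"
    have "[\<chi> (f * g) + \<psi> (f * g) = (\<chi> f + \<chi> g) + (\<psi> f + \<psi> g)] (mod int p ^ 2)"
      by (intro cong_add is_char_mult assms fg)
    then have "[\<chi> (f * g) + \<psi> (f * g) = (\<chi> f + \<psi> f) + (\<chi> g + \<psi> g)] (mod int p ^ 2)"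
      by (simp only: ac_simps)
    then show "[(\<chi> (f * g) + \<psi> (f * g)) mod int p ^ 2 =
        (\<chi> f + \<psi> f) mod int p ^ 2 + (\<chi> g + \<psi> g) mod int p ^ 2] (mod int p ^ 2)"
      by (simp add: cong_def mod_add_eq)
  next
    fix f :: "'a fps"
    assume "f \<in> Uj (max M N)"
    then have "f \<in> Uj M" "f \<in> Uj N"
      using Uj_antimono[of N "max M N"] Uj_antimono[of M "max M N"] by auto
    then show "(\<chi> f + \<psi> f) mod int p ^ 2 = 0"
      using M(2) N(2) by simp
  qed (use N in auto)
qed

lemma is_char_scale:
  assumes "is_char p \<chi>"
  shows "is_char p (\<lambda>f. (c * \<chi> f) mod int p ^ 2)"
proof -
  obtain N where N: "1 \<le> N" "\<And>f. f \<in> Uj N \<Longrightarrow> \<chi> f = 0"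
    using is_char_conductor[OF assms(1)] by metis
  show ?thesis
  proof (rule is_charI[where N = N])
    fix f :: "'a fps"
    assume "f \<in> U1"
    then have "0 < int p ^ 2"
      using is_char_range[OF assms(1), of f] by (metis atLeastLessThan_iff le_less_trans)
    then show "(c * \<chi> f) mod int p ^ 2 \<in> {0..<int p ^ 2}"
      by simp
  next
    fix f g :: "'a fps"
    assume fg: "f \<in> U1" "g \<in> U1"
    have "[c * \<chi> (f * g) = c * (\<chi> f + \<chi> g)] (mod int p ^ 2)"
      by (intro cong_mult cong_refl is_char_mult assms fg)
    then show "[(c * \<chi> (f * g)) mod int p ^ 2 =
        (c * \<chi> f) mod int p ^ 2 + (c * \<chi> g) mod int p ^ 2] (mod int p ^ 2)"
      by (simp add: cong_def mod_add_eq distrib_left)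
  qed (use N in auto)
qed

lemma is_char_sum:
  assumes "finite J" "\<And>j. j \<in> J \<Longrightarrow> is_char p (\<zeta> j)" "0 < p"
  shows "is_char p (\<lambda>f::'a::field fps. (\<Sum>j\<in>J. c j * \<zeta> j f) mod int p ^ 2)"
  using assms
proof (induction J rule: finite_induct)
  case empty
  show ?case
    by (rule is_charI[where N = 1]) (use empty in auto)
next
  case (insert k J)
  have "is_char p (\<lambda>f. ((c k * \<zeta> k f) mod int p ^ 2 + (\<Sum>j\<in>J. c j * \<zeta> j f) mod int p ^ 2)
      mod int p ^ 2)"
    using insert by (intro is_char_add is_char_scale) auto
  then show ?case
    using insert by (simp add: mod_add_eq)
qed

lemma is_char_compose:
  fixes \<chi> :: "'a::field fps \<Rightarrow> int"
  assumes \<chi>: "is_char p \<chi>" and u: "u \<in> Nottingham"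
  shows "is_char p (\<lambda>f. \<chi> (f oo u))"
proof -
  obtain N where N: "1 \<le> N" "\<And>f. f \<in> Uj N \<Longrightarrow> \<chi> f = 0"
    using is_char_conductor[OF \<chi>] by metis
  show ?thesis
  proof (rule is_charI[where N = N])
    fix f g :: "'a fps"
    assume fg: "f \<in> U1" "g \<in> U1"
    show "\<chi> (f oo u) \<in> {0..<int p ^ 2}"
      using is_char_range[OF \<chi> U1_compose[OF fg(1)]] .
    show "[\<chi> (f * g oo u) = \<chi> (f oo u) + \<chi> (g oo u)] (mod int p ^ 2)"
      using is_char_mult[OF \<chi> U1_compose[OF fg(1)] U1_compose[OF fg(2)], of u u]
        fps_compose_mult_distrib[OF Nottingham_nth_0[OF u]] by simp
  next
    fix f :: "'a fps"
    assume "f \<in> Uj N"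
    then show "\<chi> (f oo u) = 0"
      using Uj_compose(1)[OF _ N(1) u] N(2) by blast
  qed (use N in auto)
qed

section \<open>Strict equivalence is an equivalence relation\<close>

lemma strict_equiv_refl:
  fixes \<chi> :: "'a::field fps \<Rightarrow> int"
  assumes "is_char p \<chi>"
  shows "strict_equiv \<chi> \<chi>"
proof -
  have "fps_X \<in> (Nottingham :: 'a fps set)" "fps_shift 1 (fps_X :: 'a fps) = 1"
    by (auto simp: Nottingham_def fps_eq_iff)
  then show ?thesis
    unfolding strict_equiv_def using is_char_one[OF assms] by (metis fps_compose_fps_X)
qed

text \<open>The second identity is the cocycle rule for u \<mapsto> u/t; the condition \<chi>(u/t) =
  0 is compatible with composition because of it.\<close>

lemma Nottingham_compose:
  fixes u v :: "'a::field fps"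
  assumes u: "u \<in> Nottingham" and v: "v \<in> Nottingham"
  shows "v oo u \<in> Nottingham" and "fps_shift 1 (v oo u) = (fps_shift 1 v oo u) * fps_shift 1 u"
proof -
  have "v oo u = u * (fps_shift 1 v oo u)"
    using Nottingham_nth_0[OF u]
    by (subst Nottingham_eq[OF v]) (simp add: fps_compose_mult_distrib)
  also have "\<dots> = fps_X * ((fps_shift 1 v oo u) * fps_shift 1 u)"
    by (subst Nottingham_eq[OF u]) (simp add: mult_ac)
  finally have eq: "v oo u = fps_X * ((fps_shift 1 v oo u) * fps_shift 1 u)" .
  show "v oo u \<in> Nottingham"
    unfolding eq
    by (intro X_mult_in_Nottingham U1_mult U1_compose fps_shift_Nottingham u v)
  show "fps_shift 1 (v oo u) = (fps_shift 1 v oo u) * fps_shift 1 u"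
    unfolding eq by (simp add: fps_eq_iff)
qed

text \<open>By the cocycle rule \<chi> of (v o u)/t is \<chi>((v/t) o u) + \<chi>(u/t) = \<psi>(v/t)
  + 0 = 0.\<close>

lemma strict_equiv_trans:
  fixes \<chi> \<psi> \<omega> :: "'a::field fps \<Rightarrow> int"
  assumes \<chi>: "is_char p \<chi>" and "strict_equiv \<chi> \<psi>" "strict_equiv \<psi> \<omega>"
  shows "strict_equiv \<chi> \<omega>"
proof -
  obtain u where u: "u \<in> Nottingham" "\<And>f. f \<in> U1 \<Longrightarrow> \<psi> f = \<chi> (f oo u)" "\<chi> (fps_shift 1 u) = 0"
    using assms(2) unfolding strict_equiv_def by blast
  obtain v where v: "v \<in> Nottingham" "\<And>f. f \<in> U1 \<Longrightarrow> \<omega> f = \<psi> (f oo v)" "\<psi> (fps_shift 1 v) = 0"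
    using assms(3) unfolding strict_equiv_def by blast
  note sU = fps_shift_Nottingham[OF u(1)] fps_shift_Nottingham[OF v(1)]
  have "\<chi> (fps_shift 1 (v oo u)) = 0"
  proof (rule is_char_eq_0I[OF \<chi>])
    show "fps_shift 1 (v oo u) \<in> U1"
      using Nottingham_compose[OF u(1) v(1)] fps_shift_Nottingham by blast
    show "[\<chi> (fps_shift 1 (v oo u)) = 0] (mod int p ^ 2)"
      using is_char_mult[OF \<chi> U1_compose[OF sU(2)] sU(1), of u] v(3) u(2)[OF sU(2)] u(3)
        Nottingham_compose(2)[OF u(1) v(1)] by simp
  qed
  moreover have "\<omega> f = \<chi> (f oo (v oo u))" if "f \<in> U1" for f
    using that v(2) u(2)[OF U1_compose[OF that], of v]
      fps_compose_assoc[OF Nottingham_nth_0[OF u(1)] Nottingham_nth_0[OF v(1)], of f] by simp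
  ultimately show ?thesis
    unfolding strict_equiv_def using Nottingham_compose(1)[OF u(1) v(1)] by blast
qed

text \<open>For the compositional inverse w of u the cocycle rule reads ((w/t) o u) (u/t) = 1, so
  \<psi>(w/t) = \<chi>((w/t) o u) = -\<chi>(u/t) = 0.\<close>

lemma strict_equiv_sym:
  fixes \<chi> \<psi> :: "'a::field fps \<Rightarrow> int"
  assumes \<chi>: "is_char p \<chi>" and "strict_equiv \<chi> \<psi>"
  shows "strict_equiv \<psi> \<chi>"
proof -
  obtain u where u: "u \<in> Nottingham" "\<And>f. f \<in> U1 \<Longrightarrow> \<psi> f = \<chi> (f oo u)" "\<chi> (fps_shift 1 u) = 0"
    using assms(2) unfolding strict_equiv_def by blast
  define w where "w = fps_inv u"
  have wu: "w oo u = fps_X"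
    using u(1) by (auto simp: w_def Nottingham_def intro: fps_inv)
  have w: "w \<in> Nottingham"
    using u(1) by (auto simp: w_def fps_inv_def Nottingham_def)
  note sU = fps_shift_Nottingham[OF u(1)] fps_shift_Nottingham[OF w]
  have "(fps_shift 1 w oo u) * fps_shift 1 u = 1"
    using Nottingham_compose(2)[OF u(1) w] unfolding wu by (auto simp: fps_eq_iff)
  then have "[0 = \<chi> (fps_shift 1 w oo u)] (mod int p ^ 2)"
    using is_char_mult[OF \<chi> U1_compose[OF sU(2)] sU(1), of u] u(3) is_char_one[OF \<chi>] by simp
  then have "\<chi> (fps_shift 1 w oo u) = 0"
    using is_char_eq_0I[OF \<chi> U1_compose[OF sU(2)]] cong_sym by blast
  then have "\<psi> (fps_shift 1 w) = 0"
    using u(2)[OF sU(2)] by simp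
  moreover have "\<chi> f = \<psi> (f oo w)" if "f \<in> U1" for f
    using u(2)[OF U1_compose[OF that], of w] wu
      fps_compose_assoc[OF Nottingham_nth_0[OF u(1)] Nottingham_nth_0[OF w], of f] by simp
  ultimately show ?thesis
    unfolding strict_equiv_def using w by blast
qed

subsection \<open>The dual basis characters\<close>

text \<open>Exponents beyond the precision \<open>N\<close> of interest are allowed (up to \<open>R\<close>), so that
  carrying \<open>E\<^sub>n\<^sup>p = E\<^sub>p\<^sub>n\<close> never leaves the index range.\<close>
definition Ej_prod :: "nat \<Rightarrow> (nat \<Rightarrow> nat) \<Rightarrow> 'a::field fps" where
  "Ej_prod R e = (\<Prod>n=1..R. Ej n ^ e n)"

lemma Ej_prod_add: "Ej_prod R (\<lambda>n. e n + d n) = Ej_prod R e * Ej_prod R d"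
  by (simp add: Ej_prod_def power_add prod.distrib)

lemma Ej_prod_scale: "Ej_prod R (\<lambda>n. c * e n) = Ej_prod R e ^ c"
  by (simp add: Ej_prod_def prod_power_distrib mult.commute[of c] flip: power_mult)

text \<open>Exponents are natural numbers, so the old power is multiplied on the left instead of
  being divided out on the right.\<close>

lemma Ej_prod_upd:
  assumes "k \<in> {1..R}"
  shows "Ej_prod R (e(k := c)) * Ej k ^ e k = Ej_prod R e * Ej k ^ c"
proof -
  have "(\<Prod>n\<in>{1..R} - {k}. Ej n ^ (e(k := c)) n) = (\<Prod>n\<in>{1..R} - {k}. Ej n ^ e n)"
    by (intro prod.cong) auto
  then show ?thesis
    unfolding Ej_prod_def prod.remove[OF finite_atLeastAtMost assms] by (simp add: mult_ac)
qed

lemma Ej_prod_in_Uj: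
  assumes "1 \<le> n" "\<And>i. 1 \<le> i \<Longrightarrow> i < n \<Longrightarrow> e i = 0"
  shows "Ej_prod R e \<in> (Uj n :: 'a::field fps set)"
proof -
  have "(\<Prod>i\<in>A. Ej i ^ e i) \<in> (Uj n :: 'a fps set)" if "finite A" "A \<subseteq> {1..}" for A
    using that
  proof (induction A rule: finite_induct)
    case (insert i A)
    have "Ej i ^ e i \<in> (Uj n :: 'a fps set)"
    proof (cases "i < n")
      case False
      then show ?thesis
        using Uj_antimono[of n i, where 'a = 'a] Ej_power_in_Uj[of i "e i", where 'a = 'a] insert.prems
        by auto
    qed (use assms(2)[of i] insert.prems in auto)
    then have "Ej i ^ e i * (\<Prod>i\<in>A. Ej i ^ e i) \<in> (Uj n :: 'a fps set)"
      using insert assms(1) by (intro Uj_mult) auto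
    then show ?case
      using insert by simp
  qed simp
  then show ?thesis
    by (simp add: Ej_prod_def)
qed

lemma Ej_prod_in_U1: "Ej_prod R e \<in> U1"
  using Ej_prod_in_Uj[of 1] by (simp add: U1_eq_Uj)

lemma mult_nth_cong:
  fixes f g f' g' :: "'a::field fps"
  assumes "\<forall>i\<le>N. fps_nth f i = fps_nth f' i" "\<forall>i\<le>N. fps_nth g i = fps_nth g' i"
  shows "\<forall>i\<le>N. fps_nth (f * g) i = fps_nth (f' * g') i"
  using assms by (auto simp: fps_mult_nth intro!: sum.cong)

section \<open>Coefficients in the field with p elements: Frobenius and generation by the
  \<open>Ej i\<close>\<close>

locale prime_order_field =
  fixes p :: nat and field_type :: "'a::{field,finite} itself"
  assumes card_eq: "p = card (UNIV :: 'a set)" and prime_p: "prime p"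
begin

lemma CHAR_eq_p: "CHAR('a) = p"
  using CHAR_dvd_CARD[where 'a = 'a] prime_p CHAR_not_1'[where 'a = 'a]
  unfolding card_eq[symmetric] by (metis One_nat_def prime_nat_iff)

lemma of_nat_eq_0_iff_dvd: "(of_nat n :: 'a) = 0 \<longleftrightarrow> p dvd n"
  by (simp add: of_nat_eq_0_iff_char_dvd CHAR_eq_p)

text \<open>In characteristic \<open>p\<close> the images of 0, ..., p - 1 are distinct, and the
  field has only \<open>p\<close> elements. Hence any leading coefficient can be reached by a
  natural power of a fixed element.\<close>

lemma of_nat_surj: obtains n where "of_nat n = (c :: 'a)"
proof -
  have "inj_on (of_nat :: nat \<Rightarrow> 'a) {..<p}"
    by (intro inj_onI) (auto simp: of_nat_eq_iff_cong_CHAR CHAR_eq_p cong_def)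
  then have "card ((of_nat :: nat \<Rightarrow> 'a) ` {..<p}) = card (UNIV :: 'a set)"
    using card_eq by (simp add: card_image)
  then have "(of_nat :: nat \<Rightarrow> 'a) ` {..<p} = UNIV"
    by (intro card_subset_eq) auto
  then show ?thesis
    using that by (metis UNIV_I imageE)
qed

lemma p_ge_2: "2 \<le> p"
  using prime_p by (rule prime_ge_2_nat)

lemma add_power_p_power: "(f + g :: 'a fps) ^ (p ^ k) = f ^ (p ^ k) + g ^ (p ^ k)"
  using freshmans_dream'[where 'a = "'a fps" and n = k] prime_p by (simp add: CHAR_eq_p)

lemma Ej_power_p_power: "(Ej i :: 'a fps) ^ (p ^ k) = Ej (i * p ^ k)"
  by (simp add: Ej_def add_power_p_power flip: power_mult)

lemma Ej_power_p: "(Ej i :: 'a fps) ^ p = Ej (p * i)"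
  using Ej_power_p_power[of i 1] by (simp add: mult.commute)

text \<open>Both characters vanish on some common \<open>Uj N\<close>. From there one descends to
  \<open>Uj 1\<close>, splitting off a power of \<open>Ej n\<close> with the right leading
  coefficient at each level.\<close>

lemma is_char_eq_on_U1I:
  fixes \<chi> \<psi> :: "'a fps \<Rightarrow> int"
  assumes \<chi>: "is_char p \<chi>" and \<psi>: "is_char p \<psi>"
    and eq: "\<And>i. 1 \<le> i \<Longrightarrow> \<not> p dvd i \<Longrightarrow> \<chi> (Ej i) = \<psi> (Ej i)"
    and f: "f \<in> U1"
  shows "\<chi> f = \<psi> f"
proof -
  obtain N where N: "1 \<le> N" "\<And>f. f \<in> Uj N \<Longrightarrow> \<chi> f = 0"
    using is_char_conductor[OF \<chi>] by metis
  obtain M where M: "1 \<le> M" "\<And>f. f \<in> Uj M \<Longrightarrow> \<psi> f = 0"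
    using is_char_conductor[OF \<psi>] by metis
  \<comment> \<open>Frobenius extends the agreement to indices divisible by \<open>p\<close>: for n
    = i p^k the element \<open>Ej n\<close> is the p^k-th power of \<open>Ej i\<close>.\<close>
  have Ej: "\<chi> (Ej n) = \<psi> (Ej n)" if n: "1 \<le> n" for n
  proof -
    obtain k i where i: "\<not> p dvd i" "n = i * p ^ k"
      using prime_power_canonical[OF prime_p, of n] n by auto
    then have i1: "1 \<le> i"
      using n by (cases i) auto
    have "[\<chi> (Ej n) = int (p ^ k) * \<chi> (Ej i)] (mod int p ^ 2)"
      unfolding i(2) Ej_power_p_power[symmetric] by (rule is_char_power[OF \<chi> Ej_in_U1[OF i1]])
    moreover have "[\<psi> (Ej n) = int (p ^ k) * \<psi> (Ej i)] (mod int p ^ 2)"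
      unfolding i(2) Ej_power_p_power[symmetric] by (rule is_char_power[OF \<psi> Ej_in_U1[OF i1]])
    ultimately have "[\<chi> (Ej n) = \<psi> (Ej n)] (mod int p ^ 2)"
      unfolding eq[OF i1 i(1)] by (metis cong_sym cong_trans)
    then show ?thesis
      by (rule is_char_eqI[OF \<chi> \<psi> Ej_in_U1[OF n] Ej_in_U1[OF n]])
  qed
  have "\<forall>f\<in>Uj n. \<chi> f = \<psi> f" if "1 \<le> n" "n \<le> max M N" for n
    using that(2,1)
  proof (induction n rule: inc_induct)
    case base
    then show ?case
      using Uj_antimono[of N "max M N"] Uj_antimono[of M "max M N"] M(2) N(2)
      by (metis max.cobounded1 max.cobounded2 subsetD)
  next
    case (step n)
    show ?case
    proof
      fix f :: "'a fps"
      assume f: "f \<in> Uj n"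
      obtain c where c: "of_nat c = fps_nth f n"
        using of_nat_surj .
      define e where "e = (Ej n :: 'a fps) ^ c"
      have e: "e \<in> Uj n" "fps_nth e n = fps_nth f n"
        using c by (simp_all add: e_def Ej_power_in_Uj[OF step.prems] Ej_power_nth_self[OF step.prems])
      have "f * inverse e \<in> Uj (Suc n)"
        using Uj_quotient_SucI[OF f e(1) step.prems] e(2) by simp
      then have q: "\<chi> (f * inverse e) = \<psi> (f * inverse e)"
        using step.IH by simp
      have e1: "e \<in> U1" and f1: "f \<in> U1"
        using e(1) f UjD_U1 by auto
      have "[\<chi> e = int c * \<chi> (Ej n)] (mod int p ^ 2)" "[\<psi> e = int c * \<psi> (Ej n)] (mod int p ^ 2)"
        unfolding e_def by (intro is_char_power \<chi> \<psi> Ej_in_U1 step.prems)+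
      then have "[\<chi> e = \<psi> e] (mod int p ^ 2)"
        unfolding Ej[OF step.prems] by (metis cong_sym cong_trans)
      then have "[\<chi> e + \<chi> (f * inverse e) = \<psi> e + \<psi> (f * inverse e)] (mod int p ^ 2)"
        unfolding q by (intro cong_add) auto
      then have "[\<chi> f = \<psi> f] (mod int p ^ 2)"
        using is_char_quotient[OF \<chi> f1 e1] is_char_quotient[OF \<psi> f1 e1]
        by (metis cong_sym cong_trans)
      then show "\<chi> f = \<psi> f"
        by (rule is_char_eqI[OF \<chi> \<psi> f1 f1])
    qed
  qed
  from this[of 1] show ?thesis
    using f N(1) by (simp add: U1_eq_Uj)
qed

text \<open>Successive approximation: the discrepancy at degree N + 1 is removed by a power of
  \<open>Ej (Suc N)\<close>, which leaves all lower coefficients alone. The vanishing of later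
  exponents guarantees that this power is new.\<close>

lemma Ej_prod_exists:
  assumes "f \<in> (U1 :: 'a fps set)" "N \<le> R"
  shows "\<exists>e. (\<forall>i>N. e i = 0) \<and> (\<forall>i\<le>N. fps_nth (Ej_prod R e) i = fps_nth f i)"
  using assms(2)
proof (induction N)
  case 0
  show ?case
    using assms(1) by (intro exI[of _ "\<lambda>_. 0"]) (simp add: Ej_prod_def U1_def)
next
  case (Suc N)
  then obtain e where e: "\<And>i. i > N \<Longrightarrow> e i = 0"
    "\<And>i. i \<le> N \<Longrightarrow> fps_nth (Ej_prod R e) i = fps_nth f i"
    by auto
  obtain c where c: "of_nat c = fps_nth f (Suc N) - fps_nth (Ej_prod R e) (Suc N)"
    using of_nat_surj .
  define h where "h = (Ej (Suc N) :: 'a fps) ^ c"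
  have "h \<in> Uj (Suc N)" and hN: "fps_nth h (Suc N) = of_nat c"
    by (simp_all add: h_def Ej_power_in_Uj Ej_power_nth_self)
  then obtain r where r: "h = 1 + fps_X ^ Suc N * r" "fps_nth r 0 = fps_nth h (Suc N)"
    using UjE[of h "Suc N"] by auto
  have "Ej_prod R (e(Suc N := c)) = Ej_prod R e * h"
    using Ej_prod_upd[of "Suc N" R e c, where 'a = 'a] Suc.prems e(1)[of "Suc N"] by (simp add: h_def)
  also have "\<dots> = Ej_prod R e + fps_X ^ Suc N * (Ej_prod R e * r)"
    by (simp only: r(1) distrib_left mult_1_right mult.left_commute)
  finally have eq: "Ej_prod R (e(Suc N := c)) =
      Ej_prod R e + fps_X ^ Suc N * (Ej_prod R e * r)" .
  have P0: "fps_nth (Ej_prod R e :: 'a fps) 0 = 1"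
    using Ej_prod_in_U1[of R e, where 'a = 'a] by (simp add: U1_def)
  have "fps_nth (Ej_prod R (e(Suc N := c))) i = fps_nth f i" if "i \<le> Suc N" for i
    unfolding eq using that e(2)[of i] P0 c hN r(2)
    by (cases "i = Suc N") (auto simp: fps_X_power_mult_nth simp del: power_Suc)
  moreover have "\<forall>i>Suc N. (e(Suc N := c)) i = 0"
    using e(1) by simp
  ultimately show ?case
    by blast
qed

text \<open>A leading exponent of a product congruent to 1 is divisible by \<open>p\<close>, hence can be carried
  from \<open>E\<^sub>n\<close> to \<open>E\<^sub>p\<^sub>n\<close>; the quantity \<open>e j + p * e (p * j)\<close> is unchanged modulo \<open>p\<^sup>2\<close>.\<close>
lemma Ej_prod_independent:
  assumes "\<not> p dvd j" "p * j \<le> N"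
    and "\<forall>i\<le>N. fps_nth (Ej_prod (p * N) e :: 'a fps) i = fps_nth 1 i"
  shows "p ^ 2 dvd e j + p * e (p * j)"
proof -
  have j0: "1 \<le> j"
    using assms(1) by (cases j) auto
  have jN: "j \<le> N"
  proof -
    have "j \<le> p * j"
      using p_ge_2 by simp
    then show ?thesis
      using assms(2) by linarith
  qed
  \<comment> \<open>Generalised to all exponent families that vanish below \<open>n\<close>, for
    descending induction on \<open>n\<close>. At n = N + 1 both exponents in question are 0.\<close>
  have "p ^ 2 dvd e j + p * e (p * j)"
    if "1 \<le> n" "n \<le> Suc N" "\<And>i. 1 \<le> i \<Longrightarrow> i < n \<Longrightarrow> e i = 0"
      "\<forall>i\<le>N. fps_nth (Ej_prod (p * N) e :: 'a fps) i = fps_nth 1 i" for n e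
    using that(2,1,3,4)
  proof (induction n arbitrary: e rule: inc_induct)
    case base
    then show ?case
      using j0 jN assms(2) p_ge_2 by simp
  next
    case (step n)
    let ?R = "p * N"
    have nN: "n \<le> N"
      using step.hyps by simp
    have pn: "n < p * n" "p * n \<le> ?R"
      using nN p_ge_2 step.prems(1) by auto
    have nR: "n \<in> {1..?R}" and pnR: "p * n \<in> {1..?R}"
      using order_less_le_trans[OF pn] order_le_less_trans[OF step.prems(1) pn(1)] pn(2) step.prems(1)
      unfolding atLeastAtMost_iff by linarith+
    \<comment> \<open>Without \<open>Ej n ^ e n\<close> the product lies in
      \<open>Uj (Suc n)\<close>, so its full coefficient at \<open>n\<close> is \<open>e n\<close>.
      It equals that of 1, hence is zero in the field.\<close>
    have "Ej_prod ?R (e(n := 0)) * Ej n ^ e n = (Ej_prod ?R e :: 'a fps)"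
      using Ej_prod_upd[OF nR, of e 0, where 'a = 'a] by simp
    moreover have "Ej_prod ?R (e(n := 0)) \<in> (Uj (Suc n) :: 'a fps set)"
      using step.prems(2) by (intro Ej_prod_in_Uj) (auto simp: less_Suc_eq)
    moreover from this have "fps_nth (Ej_prod ?R (e(n := 0)) :: 'a fps) n = 0"
      using step.prems(1) by (auto simp: Uj_def)
    moreover have "(Ej n :: 'a fps) ^ e n \<in> Uj n" "fps_nth ((Ej n :: 'a fps) ^ e n) n = of_nat (e n)"
      using step.prems(1) by (simp_all add: Ej_power_in_Uj Ej_power_nth_self)
    ultimately have "fps_nth (Ej_prod ?R e :: 'a fps) n = of_nat (e n)"
      using Uj_mult_nth[of "Ej_prod ?R (e(n := 0)) :: 'a fps" n "Ej n ^ e n"]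
        Uj_antimono[of n "Suc n", where 'a = 'a] step.prems(1) by auto
    then have "p dvd e n"
      using step.prems(1,3) nN by (simp flip: of_nat_eq_0_iff_dvd)
    then obtain q where q: "e n = p * q"
      by blast
    define e' where "e' = e(n := 0, p * n := e (p * n) + q)"
    have "(Ej_prod ?R e' :: 'a fps) = Ej_prod ?R e"
    proof -
      let ?d = "e(n := 0)"
      have "Ej_prod ?R e' * Ej (p * n) ^ e (p * n) =
          (Ej_prod ?R ?d * Ej (p * n) ^ (e (p * n) + q) :: 'a fps)"
        using Ej_prod_upd[OF pnR, of ?d "e (p * n) + q", where 'a = 'a] pn(1) by (simp add: e'_def)
      also have "\<dots> = Ej_prod ?R ?d * Ej n ^ e n * Ej (p * n) ^ e (p * n)"
        by (simp add: q power_add power_mult Ej_power_p mult_ac)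
      also have "\<dots> = Ej_prod ?R e * Ej (p * n) ^ e (p * n)"
        using Ej_prod_upd[OF nR, of e 0, where 'a = 'a] by simp
      finally have "Ej_prod ?R e' * Ej (p * n) ^ e (p * n) =
          (Ej_prod ?R e * Ej (p * n) ^ e (p * n) :: 'a fps)" .
      moreover have "(Ej (p * n) :: 'a fps) \<noteq> 0"
        using Ej_in_U1[of "p * n", where 'a = 'a] pnR by (auto simp: U1_def)
      ultimately show ?thesis
        by simp
    qed
    moreover have "e' i = 0" if "1 \<le> i" "i < Suc n" for i
      using that step.prems(2) pn(1) by (auto simp: e'_def less_Suc_eq)
    ultimately have IH: "p ^ 2 dvd e' j + p * e' (p * j)"
      using step.IH[of e'] step.prems(3) by simp
    have jpn: "j \<noteq> p * n"
      using assms(1) by auto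
    \<comment> \<open>If n = j, the carry moves p q from the first term to the second. If n = p j,
      the carry leaves the expression and drops p^2 q. Otherwise neither exponent is
      touched.\<close>
    consider "n = j" | "n = p * j" "n \<noteq> j" | "n \<noteq> p * j" "n \<noteq> j"
      by blast
    then show ?case
    proof cases
      case 1
      then show ?thesis
        using IH jpn q by (simp add: e'_def algebra_simps)
    next
      case 2
      then have "e' j + p * e' (p * j) = e j"
        using jpn pn(1) by (simp add: e'_def)
      then have "p ^ 2 dvd e j"
        using IH by simp
      moreover have "p * e (p * j) = p ^ 2 * q"
        using q 2 by (simp add: power2_eq_square)
      ultimately show ?thesis
        by simp
    next
      case 3
      then have "e' j = e j" "e' (p * j) = e (p * j)"
        using jpn p_ge_2 by (auto simp: e'_def)
      then show ?thesis
        using IH by simp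
    qed
  qed
  from this[of 1] show ?thesis
    using assms(3) by simp
qed

text \<open>Reduces to a product congruent to 1 by dividing by the second product. As exponents must
  stay natural, its (c - 1)-th power serves as an inverse, its c-th power being 1 up to degree
  \<open>N\<close>.\<close>

lemma Ej_prod_unique:
  assumes "\<not> p dvd j" "p * j \<le> N"
    and agree: "\<forall>i\<le>N. fps_nth (Ej_prod (p * N) e :: 'a fps) i = fps_nth (Ej_prod (p * N) d) i"
  shows "[e j + p * e (p * j) = d j + p * d (p * j)] (mod p ^ 2)"
proof -
  \<comment> \<open>A power of \<open>p\<close>, so that (1 + X r)^c = 1 + X^c r^c by Frobenius. The
    exponent N + 2 yields both N < c, which makes this 1 up to degree \<open>N\<close>, and p^2 | c,
    which makes the added exponents vanish modulo p^2.\<close>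
  define c where "c = p ^ (N + 2)"
  have c: "c \<noteq> 0" "N < c" "p ^ 2 dvd c"
  proof -
    show "c \<noteq> 0" using p_ge_2 by (simp add: c_def)
    have "N + 2 < 2 ^ (N + 2)" by (rule less_exp)
    also have "\<dots> \<le> c"
      unfolding c_def using p_ge_2 by (rule power_mono) simp
    finally show "N < c" by simp
    show "p ^ 2 dvd c"
      unfolding c_def by (rule le_imp_power_dvd) simp
  qed
  let ?P = "Ej_prod (p * N) :: _ \<Rightarrow> 'a fps"
  obtain r where r: "?P d = 1 + fps_X ^ 1 * r"
    using UjE[of "?P d" 1] Ej_prod_in_U1[of "p * N" d, where 'a = 'a] by (auto simp: U1_eq_Uj)
  have "?P d ^ c = 1 + fps_X ^ c * r ^ c"
    unfolding r c_def add_power_p_power by (simp add: power_mult_distrib)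
  then have one: "fps_nth (?P d ^ c) i = fps_nth 1 i" if "i \<le> N" for i
    using that c(2) by (simp add: fps_X_power_mult_nth)
  have "\<forall>i\<le>N. fps_nth (?P e * ?P d ^ (c - 1)) i = fps_nth (?P d * ?P d ^ (c - 1)) i"
    by (rule mult_nth_cong[OF agree]) simp
  moreover have "?P d * ?P d ^ (c - 1) = ?P d ^ c"
    using c(1) by (simp flip: power_Suc)
  ultimately have "\<forall>i\<le>N. fps_nth (?P (\<lambda>n. e n + (c - 1) * d n)) i = fps_nth 1 i"
    using one by (simp add: Ej_prod_add Ej_prod_scale)
  from Ej_prod_independent[OF assms(1,2) this]
  have "p ^ 2 dvd (e j + (c - 1) * d j) + p * (e (p * j) + (c - 1) * d (p * j))" .
  also have "\<dots> = (e j + p * e (p * j)) + (c - 1) * (d j + p * d (p * j))"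
    by (simp add: algebra_simps)
  finally have e0: "[(e j + p * e (p * j)) + (c - 1) * (d j + p * d (p * j)) = 0] (mod p ^ 2)"
    by (simp add: cong_0_iff)
  have d0: "[(d j + p * d (p * j)) + (c - 1) * (d j + p * d (p * j)) = 0] (mod p ^ 2)"
  proof -
    have "(d j + p * d (p * j)) + (c - 1) * (d j + p * d (p * j)) = c * (d j + p * d (p * j))"
      using c(1) by (cases c) auto
    then show ?thesis
      using c(3) by (simp add: cong_0_iff)
  qed
  let ?x = "(c - 1) * (d j + p * d (p * j))"
  have "[?x + (e j + p * e (p * j)) = ?x + (d j + p * d (p * j))] (mod p ^ 2)"
    using cong_trans[OF e0 cong_sym[OF d0]] by (simp only: add.commute)
  then show ?thesis
    by (simp only: cong_add_lcancel_nat)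
qed

text \<open>If f is the product of the E_n^(e_n), collecting the powers of E_j gives the exponent
  e_j + p e_(pj) + p^2 e_(p^2 j) + .... Modulo p^2 only two terms survive, so knowing f up to degree
  p j suffices.\<close>

lemma dual_char_exists:
  assumes j: "\<not> p dvd j"
  shows "\<exists>\<chi>::'a fps \<Rightarrow> int. is_char p \<chi> \<and> (\<forall>f. f \<notin> U1 \<longrightarrow> \<chi> f = 0) \<and>
    (\<forall>i. 1 \<le> i \<and> \<not> p dvd i \<longrightarrow> \<chi> (Ej i) = (if i = j then 1 else 0))"
proof -
  define N where "N = p * j"
  let ?P = "Ej_prod (p * N) :: _ \<Rightarrow> 'a fps"
  \<comment> \<open>An arbitrary choice of exponents; \<open>val\<close> does not depend on it by
    \<open>Ej_prod_unique\<close>, which also makes \<chi> multiplicative.\<close>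
  define expo :: "'a fps \<Rightarrow> nat \<Rightarrow> nat"
    where "expo f = (SOME e. \<forall>i\<le>N. fps_nth (?P e) i = fps_nth f i)" for f
  define val where "val e = int (e j + p * e (p * j)) mod int p ^ 2" for e :: "nat \<Rightarrow> nat"
  define \<chi> where "\<chi> f = (if f \<in> U1 then val (expo f) else 0)" for f
  have NR: "N \<le> p * N"
    using p_ge_2 by simp
  have expo: "\<forall>i\<le>N. fps_nth (?P (expo f)) i = fps_nth f i" if "f \<in> U1" for f
    unfolding expo_def
    using Ej_prod_exists[OF that NR] by (elim exE conjE) (rule someI[of "\<lambda>e. \<forall>i\<le>N. fps_nth (?P e) i = fps_nth f i"])
  have val_cong: "val e = val d" if "[e j + p * e (p * j) = d j + p * d (p * j)] (mod p ^ 2)" for e d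
    using that unfolding val_def cong_int_iff[symmetric] by (simp add: cong_def)
  have \<chi>I: "\<chi> f = val e" if "f \<in> U1" "\<forall>i\<le>N. fps_nth (?P e) i = fps_nth f i" for f e
    using Ej_prod_unique[OF j, of N "expo f" e] expo[OF that(1)] that
    by (auto simp: \<chi>_def N_def intro!: val_cong)
  have "is_char p \<chi>"
  proof (rule is_charI[where N = "Suc N"])
    fix f :: "'a fps"
    assume f: "f \<in> U1"
    have "0 < int p ^ 2"
      using p_ge_2 by simp
    then show "\<chi> f \<in> {0..<int p ^ 2}"
      using f by (simp add: \<chi>_def val_def)
  next
    fix f g :: "'a fps"
    assume fg: "f \<in> U1" "g \<in> U1"
    have "\<chi> (f * g) = val (\<lambda>n. expo f n + expo g n)"
      using mult_nth_cong[OF expo[OF fg(1)] expo[OF fg(2)]] fg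
      by (intro \<chi>I) (auto simp: Ej_prod_add)
    also have "[val (\<lambda>n. expo f n + expo g n) = val (expo f) + val (expo g)] (mod int p ^ 2)"
      by (simp add: val_def cong_def mod_add_eq algebra_simps)
    finally show "[\<chi> (f * g) = \<chi> f + \<chi> g] (mod int p ^ 2)"
      using fg by (simp add: \<chi>_def)
  next
    fix f :: "'a fps"
    assume f: "f \<in> Uj (Suc N)"
    have "\<chi> f = val (\<lambda>_. 0)"
      using f UjD_U1[OF f] by (intro \<chi>I) (auto simp: Ej_prod_def Uj_def)
    then show "\<chi> f = 0"
      by (simp add: val_def)
  qed simp
  moreover have "\<chi> (Ej i) = (if i = j then 1 else 0)" if i: "1 \<le> i" "\<not> p dvd i" for i
  proof (cases "i \<le> N")
    case True
    let ?d = "(\<lambda>_. 0)(i := 1)"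
    have "?P ?d = Ej i"
      using Ej_prod_upd[of i "p * N" "\<lambda>_. 0" 1, where 'a = 'a] True NR i(1) by (simp add: Ej_prod_def)
    then have "\<chi> (Ej i) = val ?d"
      using Ej_in_U1[OF i(1)] by (intro \<chi>I) auto
    also have "\<dots> = (if i = j then 1 else 0)"
    proof -
      have "1 < int p ^ 2"
        using p_ge_2 by (intro one_less_power) auto
      moreover have "i \<noteq> p * j"
        using i(2) by auto
      ultimately show ?thesis
        by (auto simp: val_def)
    qed
    finally show ?thesis .
  next
    case False
    have "\<chi> (Ej i) = val (\<lambda>_. 0)"
      using Ej_in_U1[OF i(1)] Ej_in_Uj[OF i(1), where 'a = 'a] False
      by (intro \<chi>I) (auto simp: Ej_prod_def Uj_def)
    moreover have "i \<noteq> j"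
      using False p_ge_2 by (auto simp: N_def)
    ultimately show ?thesis
      by (simp add: val_def)
  qed
  ultimately show ?thesis
    by (intro exI[of _ \<chi>]) (auto simp: \<chi>_def)
qed

text \<open>The definite description is legitimate: a dual character exists, its values at the
  \<open>Ej i\<close> determine it on \<open>U1\<close>, and outside \<open>U1\<close> it is
  normalised to 0.\<close>

lemma Zfrak:
  assumes "\<not> p dvd j"
  shows is_char_Zfrak: "is_char p (Zfrak p j :: 'a fps \<Rightarrow> int)"
    and Zfrak_Ej: "\<And>i. 1 \<le> i \<Longrightarrow> \<not> p dvd i \<Longrightarrow> Zfrak p j (Ej i :: 'a fps) = (if i = j then 1 else 0)"
proof -
  let ?Q = "\<lambda>\<chi>::'a fps \<Rightarrow> int. is_char p \<chi> \<and> (\<forall>f. f \<notin> U1 \<longrightarrow> \<chi> f = 0) \<and>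
      (\<forall>i. 1 \<le> i \<and> \<not> p dvd i \<longrightarrow> \<chi> (Ej i) = (if i = j then 1 else 0))"
  obtain \<chi> where \<chi>: "?Q \<chi>"
    using dual_char_exists[OF assms] by blast
  have uniq: "\<psi> = \<chi>" if \<psi>: "?Q \<psi>" for \<psi>
  proof
    fix f
    show "\<psi> f = \<chi> f"
      using is_char_eq_on_U1I[of \<psi> \<chi> f] \<chi> \<psi> by (cases "f \<in> U1") auto
  qed
  have "Zfrak p j = \<chi>"
    unfolding Zfrak_def by (rule the_equality[of ?Q, OF \<chi> uniq])
  then show "is_char p (Zfrak p j :: 'a fps \<Rightarrow> int)"
    "\<And>i. 1 \<le> i \<Longrightarrow> \<not> p dvd i \<Longrightarrow> Zfrak p j (Ej i :: 'a fps) = (if i = j then 1 else 0)"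
    using \<chi> by auto
qed

end

subsection \<open>Characters of a given type\<close>

lemma char_typeD:
  assumes "char_type p \<chi> l m"
  shows char_type_l_ge_1: "1 \<le> l" and char_type_m_ge_1: "1 \<le> m"
    and char_type_dvd: "f \<in> Uj (Suc l) \<Longrightarrow> int p dvd \<chi> f"
    and char_type_eq_0: "f \<in> Uj (Suc m) \<Longrightarrow> \<chi> f = 0"
    and char_type_not_dvd: "\<exists>f\<in>Uj l. \<not> int p dvd \<chi> f"
    and char_type_neq_0: "\<exists>f\<in>Uj m. \<chi> f \<noteq> 0"
  using assms unfolding char_type_def by auto

lemma char_typeI:
  assumes "1 \<le> l" "1 \<le> m" "\<And>f. f \<in> Uj (Suc l) \<Longrightarrow> int p dvd \<chi> f"
    "\<And>f. f \<in> Uj (Suc m) \<Longrightarrow> \<chi> f = 0"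
    "\<exists>f\<in>Uj l. \<not> int p dvd \<chi> f" "\<exists>f\<in>Uj m. \<chi> f \<noteq> 0"
  shows "char_type p \<chi> l m"
proof -
  have "int p dvd \<chi> f" if "l < b" "f \<in> Uj b" for b f
    using assms(3) Uj_antimono[of "Suc l" b] that by auto
  moreover have "\<chi> f = 0" if "m < b" "f \<in> Uj b" for b f
    using assms(4) Uj_antimono[of "Suc m" b] that by auto
  ultimately show ?thesis
    using assms(1,2,5,6) unfolding char_type_def by simp
qed

text \<open>The modulus \<open>M\<close> is kept general so that one argument serves both
  \<open>int p\<close>, for the break \<open>l\<close>, and \<open>int p ^ 2\<close>, for the break
  \<open>m\<close>.\<close>

lemma is_char_cong_of_quotient:
  assumes "is_char p \<chi>" "f \<in> U1" "g \<in> U1" "M dvd int p ^ 2" "M dvd \<chi> (f * inverse g)"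
  shows "[\<chi> f = \<chi> g] (mod M)"
proof -
  have "[\<chi> f = \<chi> g + \<chi> (f * inverse g)] (mod M)"
    using is_char_quotient[OF assms(1-3)] assms(4) cong_dvd_modulus by blast
  also have "[\<chi> g + \<chi> (f * inverse g) = \<chi> g + 0] (mod M)"
    using assms(5) by (intro cong_add) (auto simp: cong_0_iff)
  finally show ?thesis by simp
qed

lemma is_char_compose_leading_cong:
  fixes \<chi> :: "'a::field fps \<Rightarrow> int"
  assumes "is_char p \<chi>" "u \<in> Nottingham" "f \<in> Uj n" "1 \<le> n" "M dvd int p ^ 2"
    and "\<And>f. f \<in> Uj (Suc n) \<Longrightarrow> M dvd \<chi> f"
  shows "[\<chi> (f oo u) = \<chi> f] (mod M)"
proof (rule is_char_cong_of_quotient[OF assms(1) _ _ assms(5)])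
  show "f \<in> U1" "f oo u \<in> U1"
    using UjD_U1[OF assms(3)] U1_compose by auto
  show "M dvd \<chi> ((f oo u) * inverse f)"
    using Uj_compose[OF assms(3,4,2)] assms(3,4,6) Uj_quotient_SucI by blast
qed

lemma strict_equiv_substI:
  fixes \<chi> :: "'a::field fps \<Rightarrow> int"
  assumes "u \<in> Nottingham" "\<chi> (fps_shift 1 u) = 0"
  shows "strict_equiv \<chi> (\<lambda>f. \<chi> (f oo u))"
  unfolding strict_equiv_def using assms by blast

text \<open>Substitution does not change leading coefficients, so \<psi> and \<chi> agree modulo
  \<open>p\<close> on \<open>Uj l\<close> and exactly on \<open>Uj m\<close>; both breaks can be
  read off there.\<close>

lemma char_type_compose:
  fixes \<chi> \<psi> :: "'a::field fps \<Rightarrow> int"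
  assumes \<chi>: "is_char p \<chi>" and type: "char_type p \<chi> l m" and u: "u \<in> Nottingham"
    and \<psi>: "\<And>f. f \<in> U1 \<Longrightarrow> \<psi> f = \<chi> (f oo u)"
  shows "char_type p \<psi> l m"
proof -
  have mod_p: "[\<psi> f = \<chi> f] (mod int p)" if "f \<in> Uj l" for f
    using is_char_compose_leading_cong[OF \<chi> u that char_type_l_ge_1[OF type], of "int p"]
      char_type_dvd[OF type] \<psi>[OF UjD_U1[OF that]] by simp
  have mod_pp: "[\<psi> f = \<chi> f] (mod int p ^ 2)" if "f \<in> Uj m" for f
    using is_char_compose_leading_cong[OF \<chi> u that char_type_m_ge_1[OF type], of "int p ^ 2"]
      char_type_eq_0[OF type] \<psi>[OF UjD_U1[OF that]] by simp
  have eq: "\<psi> f = \<chi> f" if "f \<in> Uj m" for f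
    using is_char_eqI[OF \<chi> \<chi> U1_compose[OF UjD_U1[OF that]] UjD_U1[OF that], of u]
      mod_pp[OF that] \<psi>[OF UjD_U1[OF that]] by simp
  have sub: "f \<in> Uj l" if "f \<in> Uj (Suc l)" for f :: "'a fps"
    using that Uj_antimono[of l "Suc l"] by auto
  have sub': "f \<in> Uj m" if "f \<in> Uj (Suc m)" for f :: "'a fps"
    using that Uj_antimono[of m "Suc m"] by auto
  show ?thesis
  proof (rule char_typeI)
    fix f :: "'a fps"
    show "int p dvd \<psi> f" if "f \<in> Uj (Suc l)"
      using cong_dvd_iff[OF mod_p[OF sub[OF that]]] char_type_dvd[OF type that] by simp
    show "\<psi> f = 0" if "f \<in> Uj (Suc m)"
      using eq[OF sub'[OF that]] char_type_eq_0[OF type that] by simp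
  next
    show "\<exists>f\<in>Uj l. \<not> int p dvd \<psi> f"
      using char_type_not_dvd[OF type] cong_dvd_iff[OF mod_p] by auto
    show "\<exists>f\<in>Uj m. \<psi> f \<noteq> 0"
      using char_type_neq_0[OF type] eq by auto
  qed (use char_typeD[OF type] in auto)
qed

text \<open>The quotient of \<open>Ej i oo u\<close> by \<open>Ej i\<close> lies in
  \<open>Uj (i + k)\<close>, where \<chi> is already divisible by \<open>M\<close>. This controls
  which values a substitution leaves intact.\<close>

lemma Ej_compose_cong:
  fixes \<chi> :: "'a::field fps \<Rightarrow> int"
  assumes \<chi>: "is_char p \<chi>" and u: "u \<in> Nottingham" "fps_shift 1 u \<in> Uj k" and k: "1 \<le> k"
    and i: "1 \<le> i" and M: "M dvd int p ^ 2" and n: "n \<le> i + k"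
    and kills: "\<And>f. f \<in> Uj n \<Longrightarrow> M dvd \<chi> f"
  shows "[\<chi> (Ej i oo u) = \<chi> (Ej i)] (mod M)"
proof -
  obtain h where h: "h \<in> Uj (i + k)" "Ej i oo u = Ej i * h"
    using Ej_compose[OF u k i] by metis
  have "[\<chi> (Ej i oo u) = \<chi> (Ej i) + \<chi> h] (mod M)"
    unfolding h(2)
    using is_char_mult[OF \<chi> Ej_in_U1[OF i] UjD_U1[OF h(1)]] M cong_dvd_modulus by blast
  also have "[\<chi> (Ej i) + \<chi> h = \<chi> (Ej i) + 0] (mod M)"
    using kills[of h] h(1) Uj_antimono[OF n] by (intro cong_add) (auto simp: cong_0_iff)
  finally show ?thesis by simp
qed

section \<open>Leading coefficients and the values taken at the two breaks\<close>

context prime_order_field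
begin

text \<open>\<open>Uj n\<close> modulo \<open>Uj (Suc n)\<close> has order \<open>p\<close>, so it
  is generated by any \<open>h\<close> with nonzero leading coefficient: f is a power of h up to a
  factor in \<open>Uj (Suc n)\<close>.\<close>

lemma leading_dvd_imp_dvd:
  fixes \<chi> :: "'a fps \<Rightarrow> int"
  assumes \<chi>: "is_char p \<chi>" and M: "M dvd int p ^ 2" and n: "1 \<le> n"
    and kills: "\<And>f. f \<in> Uj (Suc n) \<Longrightarrow> M dvd \<chi> f"
    and h: "h \<in> Uj n" "fps_nth h n \<noteq> 0" "M dvd \<chi> h" and f: "f \<in> Uj n"
  shows "M dvd \<chi> f"
proof -
  obtain c where c: "of_nat c = fps_nth f n / fps_nth h n"
    using of_nat_surj .
  have hc: "h ^ c \<in> Uj n" "fps_nth (h ^ c) n = fps_nth f n"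
    using Uj_power[OF h(1) n, of c] c h(2) by auto
  have "[\<chi> f = \<chi> (h ^ c)] (mod M)"
    using Uj_quotient_SucI[OF f hc(1) n] hc(2)
    by (intro is_char_cong_of_quotient[OF \<chi> _ _ M] kills UjD_U1[OF f] UjD_U1[OF hc(1)]) auto
  also have "[\<chi> (h ^ c) = int c * \<chi> h] (mod M)"
    using is_char_power[OF \<chi> UjD_U1[OF h(1)]] M cong_dvd_modulus by blast
  finally show ?thesis
    using cong_dvd_iff h(3) by (metis dvd_mult)
qed

lemma not_dvd_of_leading:
  fixes \<chi> :: "'a fps \<Rightarrow> int"
  assumes "is_char p \<chi>" "char_type p \<chi> l m" "h \<in> Uj l" "fps_nth h l \<noteq> 0"
  shows "\<not> int p dvd \<chi> h"
  using leading_dvd_imp_dvd[OF assms(1) _ char_type_l_ge_1[OF assms(2)], of "int p" h]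
    char_type_dvd[OF assms(2)] char_type_not_dvd[OF assms(2)] assms(3,4) by auto

lemma neq_0_of_leading:
  fixes \<chi> :: "'a fps \<Rightarrow> int"
  assumes "is_char p \<chi>" "char_type p \<chi> l m" "h \<in> Uj m" "fps_nth h m \<noteq> 0"
  shows "\<chi> h \<noteq> 0"
proof
  assume "\<chi> h = 0"
  obtain f where f: "f \<in> Uj m" "\<chi> f \<noteq> 0"
    using char_type_neq_0[OF assms(2)] by blast
  have "int p ^ 2 dvd \<chi> f"
    using leading_dvd_imp_dvd[OF assms(1) _ char_type_m_ge_1[OF assms(2)], of "int p ^ 2" h f]
      char_type_eq_0[OF assms(2)] assms(3,4) f(1) \<open>\<chi> h = 0\<close> by simp
  then show False
    using f(2) is_char_eq_0I[OF assms(1) UjD_U1[OF f(1)]] by (simp add: cong_0_iff)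
qed

text \<open>Take f in \<open>Uj l\<close> with \<chi>(f) prime to \<open>p\<close>. The leading
  coefficient of f^p is multiplied by p = 0, so f^p lies in \<open>Uj (Suc l)\<close>, yet
  \<chi>(f^p) = p \<chi>(f) is nonzero.\<close>

lemma char_type_l_less_m:
  fixes \<chi> :: "'a fps \<Rightarrow> int"
  assumes \<chi>: "is_char p \<chi>" and type: "char_type p \<chi> l m"
  shows "l < m"
proof (rule ccontr)
  assume "\<not> l < m"
  obtain f where f: "f \<in> Uj l" "\<not> int p dvd \<chi> f"
    using char_type_not_dvd[OF type] by blast
  have "f ^ p \<in> Uj (Suc l)"
    using Uj_power[OF f(1) char_type_l_ge_1[OF type], of p] of_nat_eq_0_iff_dvd[of p]
      char_type_l_ge_1[OF type] by (intro Uj_SucI) auto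
  then have "\<chi> (f ^ p) = 0"
    using \<open>\<not> l < m\<close> char_type_eq_0[OF type] Uj_antimono[of "Suc m" "Suc l"] by auto
  then have "[0 = int p * \<chi> f] (mod int p ^ 2)"
    using is_char_power[OF \<chi> UjD_U1[OF f(1)], of p] by simp
  then have "int p * int p dvd int p * \<chi> f"
    by (simp add: cong_0_iff cong_sym_eq[of 0] power2_eq_square)
  then show False
    using f(2) p_ge_2 by simp
qed

text \<open>Powers of f remain in \<open>Uj n\<close>, and by Bezout the multiples of \<chi>(f)
  modulo p^2 are exactly the multiples of the gcd.\<close>

lemma char_attains:
  fixes \<chi> :: "'a fps \<Rightarrow> int"
  assumes "is_char p \<chi>" "f \<in> Uj n" "1 \<le> n" "gcd (\<chi> f) (int p ^ 2) dvd v"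
  obtains g where "g \<in> Uj n" "[\<chi> g = v] (mod int p ^ 2)"
proof -
  obtain w where w: "v = gcd (\<chi> f) (int p ^ 2) * w"
    using assms(4) by blast
  obtain a b where ab: "a * \<chi> f + b * int p ^ 2 = gcd (\<chi> f) (int p ^ 2)"
    using bezout_int by blast
  define k where "k = nat ((a * w) mod int p ^ 2)"
  have "0 < int p ^ 2"
    using p_ge_2 by simp
  then have "int k = (a * w) mod int p ^ 2"
    by (simp add: k_def)
  then have "[int k = a * w] (mod int p ^ 2)"
    by (simp add: cong_def)
  then have "[int k * \<chi> f = a * w * \<chi> f] (mod int p ^ 2)"
    by (intro cong_mult) auto
  also have "a * w * \<chi> f = v - b * w * int p ^ 2"
    unfolding w ab[symmetric] by (simp add: algebra_simps)
  also have "[v - b * w * int p ^ 2 = v] (mod int p ^ 2)"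
    by (simp add: cong_iff_dvd_diff)
  finally have "[\<chi> (f ^ k) = v] (mod int p ^ 2)"
    using is_char_power[OF assms(1) UjD_U1[OF assms(2)], of k] cong_trans by blast
  then show ?thesis
    using that Uj_power[OF assms(2,3)] by blast
qed

lemma char_attains_l:
  fixes \<chi> :: "'a fps \<Rightarrow> int"
  assumes "is_char p \<chi>" "char_type p \<chi> l m"
  obtains g where "g \<in> Uj l" "[\<chi> g = v] (mod int p ^ 2)"
proof -
  obtain f where f: "f \<in> Uj l" "\<not> int p dvd \<chi> f"
    using char_type_not_dvd[OF assms(2)] by blast
  have "coprime (int p) (\<chi> f)"
    using prime_imp_coprime[of "int p" "\<chi> f"] prime_p f(2) by simp
  then have "gcd (\<chi> f) (int p ^ 2) = 1"
    by (simp add: coprime_commute)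
  then show ?thesis
    using char_attains[OF assms(1) f(1) char_type_l_ge_1[OF assms(2)], of v] that by auto
qed

text \<open>A nonzero value has as gcd with p^2 a power of \<open>p\<close> other than p^2 itself,
  hence a divisor of \<open>p\<close>.\<close>

lemma char_attains_m:
  fixes \<chi> :: "'a fps \<Rightarrow> int"
  assumes "is_char p \<chi>" "char_type p \<chi> l m" "int p dvd v"
  obtains g where "g \<in> Uj m" "[\<chi> g = v] (mod int p ^ 2)"
proof -
  obtain f where f: "f \<in> Uj m" "\<chi> f \<noteq> 0"
    using char_type_neq_0[OF assms(2)] by blast
  have "\<not> int p ^ 2 dvd \<chi> f"
    using f(2) is_char_eq_0I[OF assms(1) UjD_U1[OF f(1)]] by (auto simp: cong_0_iff)
  moreover have "gcd (\<chi> f) (int p ^ 2) dvd int p ^ 2"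
    by simp
  then obtain k where k: "k \<le> 2" "gcd (\<chi> f) (int p ^ 2) = int p ^ k"
    using divides_primepow[of "int p" "gcd (\<chi> f) (int p ^ 2)" 2] prime_p by auto
  ultimately have "k \<noteq> 2"
    by (metis gcd_dvd1)
  then have "gcd (\<chi> f) (int p ^ 2) dvd int p"
    using k by (cases "k = 0") (auto simp: le_less numeral_2_eq_2 less_Suc_eq)
  then show ?thesis
    using char_attains[OF assms(1) f(1) char_type_m_ge_1[OF assms(2)], of v] that assms(3)
      dvd_trans by blast
qed

text \<open>The substitution \<open>u = t (1 + c t\<^sup>n\<^sup>-\<^sup>j + \<dots>)\<close> multiplies \<open>E\<^sub>j\<close> by \<open>1 + j c t\<^sup>n + \<dots>\<close> and changes
  the \<open>E\<^sub>i\<close> with \<open>i > j\<close> only beyond level \<open>n\<close>; its higher terms are free to achieve \<open>\<chi>(u/t) = 0\<close>.\<close>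
lemma adjust_at_Ej:
  fixes \<chi> :: "'a fps \<Rightarrow> int"
  assumes \<chi>: "is_char p \<chi>" and M: "M dvd int p ^ 2"
    and j: "1 \<le> j" "j < n" "\<not> p dvd j" and f: "f \<in> Uj n"
    and kills: "\<And>f. f \<in> Uj (Suc n) \<Longrightarrow> M dvd \<chi> f"
    and lift: "\<And>g. g \<in> Uj (n - j) \<Longrightarrow> \<exists>h\<in>Uj (Suc (n - j)). [\<chi> h = - \<chi> g] (mod int p ^ 2)"
  obtains u where "u \<in> Nottingham" "fps_shift 1 u \<in> Uj (n - j)" "\<chi> (fps_shift 1 u) = 0"
    "[\<chi> (Ej j oo u) = \<chi> (Ej j) + \<chi> f] (mod M)"
proof -
  define k where "k = n - j"
  have k: "1 \<le> k" "j + k = n"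
    using j by (auto simp: k_def)
  \<comment> \<open>Dividing by \<open>j\<close> cancels the factor that \<open>Ej_compose\<close>
    produces, so that the quotient of \<open>Ej j oo u\<close> by \<open>Ej j\<close> gets the
    leading coefficient of \<open>f\<close>.\<close>
  define c where "c = fps_nth f n / of_nat j"
  define g0 where "g0 = 1 + fps_X ^ k * fps_const c"
  have g0: "g0 \<in> Uj k" "fps_nth g0 k = c"
    using one_plus_X_power_mult_in_Uj[OF k(1)] k(1) by (auto simp: g0_def fps_X_power_mult_nth)
  \<comment> \<open>The correction \<open>h\<close> cancels \<chi>(g0) from a deeper level and so
    keeps the coefficient \<open>c\<close> at \<open>k\<close>.\<close>
  obtain h where h: "h \<in> Uj (Suc k)" "[\<chi> h = - \<chi> g0] (mod int p ^ 2)"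
    using lift g0(1) unfolding k_def by blast
  have hk: "h \<in> Uj k" "fps_nth h k = 0"
    using h(1) Uj_antimono[of k "Suc k"] k(1) by (auto simp: Uj_def)
  define g where "g = g0 * h"
  have g: "g \<in> Uj k" "fps_nth g k = c"
    using Uj_mult[OF g0(1) hk(1) k(1)] Uj_mult_nth[OF g0(1) hk(1) k(1)] g0(2) hk(2)
    by (auto simp: g_def)
  have "[\<chi> g = \<chi> g0 + \<chi> h] (mod int p ^ 2)"
    unfolding g_def by (rule is_char_mult[OF \<chi> UjD_U1[OF g0(1)] UjD_U1[OF h(1)]])
  also have "[\<chi> g0 + \<chi> h = \<chi> g0 + - \<chi> g0] (mod int p ^ 2)"
    by (intro cong_add h(2)) simp
  finally have \<chi>g: "\<chi> g = 0"
    using is_char_eq_0I[OF \<chi> UjD_U1[OF g(1)]] by simp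
  define u where "u = fps_X * g"
  have u: "u \<in> Nottingham" "fps_shift 1 u = g"
    using X_mult_in_Nottingham[OF UjD_U1[OF g(1)]] by (auto simp: u_def fps_eq_iff)
  obtain r where r: "r \<in> Uj (j + k)" "Ej j oo u = Ej j * r" "fps_nth r (j + k) = of_nat j * fps_nth g k"
    using Ej_compose[OF u(1) _ k(1) j(1)] g(1) unfolding u(2) by metis
  have "fps_nth r n = fps_nth f n"
    using r(3) g(2) k(2) j(3) of_nat_eq_0_iff_dvd[of j] by (simp add: c_def)
  then have "[\<chi> r = \<chi> f] (mod M)"
    using r(1) f j(1,2) k(2)
    by (intro is_char_cong_of_quotient[OF \<chi> _ _ M] kills Uj_quotient_SucI) (auto intro: UjD_U1)
  then have "[\<chi> (Ej j) + \<chi> r = \<chi> (Ej j) + \<chi> f] (mod M)"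
    by (intro cong_add) auto
  moreover have "[\<chi> (Ej j oo u) = \<chi> (Ej j) + \<chi> r] (mod M)"
    unfolding r(2)
    using is_char_mult[OF \<chi> Ej_in_U1[OF j(1)] UjD_U1[OF r(1)]] M cong_dvd_modulus by blast
  ultimately have "[\<chi> (Ej j oo u) = \<chi> (Ej j) + \<chi> f] (mod M)"
    using cong_trans by blast
  then show ?thesis
    using that[of u] u g(1) \<chi>g by (simp add: k_def)
qed

section \<open>Existence: clearing coefficients by substitution\<close>

lemma exists_equiv_dvd_below_l:
  fixes \<chi> :: "'a fps \<Rightarrow> int"
  assumes \<chi>: "is_char p \<chi>" and type: "char_type p \<chi> l m" and lp: "l < p"
    and j: "1 \<le> j" "j \<le> l"
  shows "\<exists>\<psi>. is_char p \<psi> \<and> strict_equiv \<chi> \<psi> \<and> char_type p \<psi> l m \<and>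
    (\<forall>i. j \<le> i \<and> i < l \<longrightarrow> int p dvd \<psi> (Ej i))"
  using j(2,1)
proof (induction j rule: inc_induct)
  case base
  then show ?case
    using \<chi> type strict_equiv_refl[OF \<chi>] by (intro exI[of _ \<chi>]) auto
next
  case (step j)
  then obtain \<psi> where \<psi>: "is_char p \<psi>" "strict_equiv \<chi> \<psi>" "char_type p \<psi> l m"
    "\<And>i. Suc j \<le> i \<Longrightarrow> i < l \<Longrightarrow> int p dvd \<psi> (Ej i)"
    by auto
  have j: "1 \<le> j" "j < l" "\<not> p dvd j"
    using step.prems step.hyps lp by (auto dest: dvd_imp_le)
  obtain f where f: "f \<in> Uj l" "[\<psi> f = - \<psi> (Ej j)] (mod int p ^ 2)"
    using char_attains_l[OF \<psi>(1,3)] .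
  \<comment> \<open>All values modulo p^2 occur on \<open>Uj l\<close>, and j \<ge> 1 puts
    \<open>Uj l\<close> inside \<open>Uj (Suc (l - j))\<close>.\<close>
  have lift: "\<exists>h\<in>Uj (Suc (l - j)). [\<psi> h = - \<psi> g] (mod int p ^ 2)" for g
  proof -
    obtain h where "h \<in> Uj l" "[\<psi> h = - \<psi> g] (mod int p ^ 2)"
      using char_attains_l[OF \<psi>(1,3)] .
    moreover have "Suc (l - j) \<le> l"
      using j by simp
    ultimately show ?thesis
      using Uj_antimono by blast
  qed
  have pdvd: "int p dvd int p ^ 2"
    by simp
  obtain u where u: "u \<in> Nottingham" "fps_shift 1 u \<in> Uj (l - j)" "\<psi> (fps_shift 1 u) = 0"
    "[\<psi> (Ej j oo u) = \<psi> (Ej j) + \<psi> f] (mod int p)"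
    using adjust_at_Ej[OF \<psi>(1) pdvd j f(1) char_type_dvd[OF \<psi>(3)] lift] by metis
  let ?\<psi> = "\<lambda>f. \<psi> (f oo u)"
  have "int p dvd ?\<psi> (Ej i)" if i: "j \<le> i" "i < l" for i
  proof (cases "i = j")
    case True
    have "[\<psi> f = - \<psi> (Ej j)] (mod int p)"
      using cong_dvd_modulus[OF f(2) pdvd] .
    then have "[\<psi> (Ej j) + \<psi> f = \<psi> (Ej j) + - \<psi> (Ej j)] (mod int p)"
      by (intro cong_add) auto
    then have "[\<psi> (Ej j oo u) = 0] (mod int p)"
      using cong_trans[OF u(4)] by simp
    then show ?thesis
      using True by (simp add: cong_0_iff)
  next
    \<comment> \<open>For i > j one has i + (l - j) > l, so the change at \<open>Ej i\<close> is
      divisible by \<open>p\<close>.\<close>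
    case False
    have "[\<psi> (Ej i oo u) = \<psi> (Ej i)] (mod int p)"
      by (rule Ej_compose_cong[OF \<psi>(1) u(1,2) _ _ pdvd, where n = "Suc l"])
        (use char_type_dvd[OF \<psi>(3)] i False j in auto)
    then show ?thesis
      using cong_dvd_iff \<psi>(4)[of i] i False by auto
  qed
  then show ?case
    using is_char_compose[OF \<psi>(1) u(1)] char_type_compose[OF \<psi>(1,3) u(1)]
      strict_equiv_trans[OF \<chi> \<psi>(2) strict_equiv_substI[of u \<psi>, OF u(1,3)]]
    by (intro exI[of _ ?\<psi>]) auto
qed

text \<open>Values are representatives in [0, p^2), so being less than \<open>int p\<close>
  expresses that the coefficient of p Z_i is zero.\<close>

lemma exists_equiv_small_below_window:
  fixes \<chi> :: "'a fps \<Rightarrow> int"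
  assumes \<chi>: "is_char p \<chi>" and type: "char_type p \<chi> l m" and lp: "l < p"
    and j: "1 \<le> j" "j \<le> m - l"
  shows "\<exists>\<psi>. is_char p \<psi> \<and> strict_equiv \<chi> \<psi> \<and> char_type p \<psi> l m \<and>
    (\<forall>i. 1 \<le> i \<and> i < l \<longrightarrow> int p dvd \<psi> (Ej i)) \<and>
    (\<forall>i. j \<le> i \<and> i < m - l \<and> \<not> p dvd i \<longrightarrow> \<psi> (Ej i) < int p)"
  using j(2,1)
proof (induction j rule: inc_induct)
  case base
  obtain \<psi> where "is_char p \<psi> \<and> strict_equiv \<chi> \<psi> \<and> char_type p \<psi> l m \<and>
      (\<forall>i. 1 \<le> i \<and> i < l \<longrightarrow> int p dvd \<psi> (Ej i))"
    using exists_equiv_dvd_below_l[OF \<chi> type lp, of 1] char_type_l_ge_1[OF type] by blast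
  then show ?case
    by (intro exI[of _ \<psi>]) auto
next
  case (step j)
  then obtain \<psi> where \<psi>: "is_char p \<psi>" "strict_equiv \<chi> \<psi>" "char_type p \<psi> l m"
    "\<And>i. 1 \<le> i \<Longrightarrow> i < l \<Longrightarrow> int p dvd \<psi> (Ej i)"
    "\<And>i. Suc j \<le> i \<Longrightarrow> i < m - l \<Longrightarrow> \<not> p dvd i \<Longrightarrow> \<psi> (Ej i) < int p"
    by auto
  show ?case
  proof (cases "p dvd j")
    \<comment> \<open>The bound concerns only indices prime to \<open>p\<close>, so \<psi> can be
      kept.\<close>
    case True
    then have "\<psi> (Ej i) < int p" if "j \<le> i" "i < m - l" "\<not> p dvd i" for i
      using \<psi>(5)[of i] that by (cases "i = j") auto
    then show ?thesis
      using \<psi>(1-4) by (intro exI[of _ \<psi>]) auto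
  next
    case False
    have j: "1 \<le> j" "j < m" "\<not> p dvd j"
      using step.prems step.hyps False by auto
    have k: "Suc l \<le> m - j"
      using step.hyps by simp
    have E1: "Ej j \<in> (U1 :: 'a fps set)"
      using Ej_in_U1[OF j(1)] .
    \<comment> \<open>The target value is minus the p-part of \<psi>(E_j); being a multiple of
      \<open>p\<close>, it is attained on \<open>Uj m\<close>.\<close>
    obtain f where f: "f \<in> Uj m" "[\<psi> f = - (int p * (\<psi> (Ej j) div int p))] (mod int p ^ 2)"
      using char_attains_m[OF \<psi>(1,3)] by (metis dvd_minus_iff dvd_triv_left)
    \<comment> \<open>Here m - j > l forces p | \<psi>(g), so the correction can be taken from
      \<open>Uj m\<close>, where all multiples of \<open>p\<close> are attained.\<close>
    have lift: "\<exists>h\<in>Uj (Suc (m - j)). [\<psi> h = - \<psi> g] (mod int p ^ 2)" if "g \<in> Uj (m - j)" for g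
    proof -
      have "int p dvd - \<psi> g"
        using char_type_dvd[OF \<psi>(3)] Uj_antimono[OF k] that by auto
      then obtain h where "h \<in> Uj m" "[\<psi> h = - \<psi> g] (mod int p ^ 2)"
        using char_attains_m[OF \<psi>(1,3)] by metis
      moreover have "Suc (m - j) \<le> m"
        using j by simp
      ultimately show ?thesis
        using Uj_antimono by blast
    qed
    have kills: "int p ^ 2 dvd \<psi> f" if "f \<in> Uj (Suc m)" for f
      using char_type_eq_0[OF \<psi>(3) that] by simp
    obtain u where u: "u \<in> Nottingham" "fps_shift 1 u \<in> Uj (m - j)" "\<psi> (fps_shift 1 u) = 0"
      "[\<psi> (Ej j oo u) = \<psi> (Ej j) + \<psi> f] (mod int p ^ 2)"
      using adjust_at_Ej[OF \<psi>(1) dvd_refl j f(1) kills lift] by metis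
    let ?\<psi> = "\<lambda>f. \<psi> (f oo u)"
    have "?\<psi> (Ej i) < int p" if i: "j \<le> i" "i < m - l" "\<not> p dvd i" for i
    proof (cases "i = j")
      case True
      have "[\<psi> (Ej j) + \<psi> f = \<psi> (Ej j) + - (int p * (\<psi> (Ej j) div int p))] (mod int p ^ 2)"
        by (intro cong_add f(2)) simp
      then have "[\<psi> (Ej j oo u) = \<psi> (Ej j) mod int p] (mod int p ^ 2)"
        using cong_trans[OF u(4)] by (simp add: minus_mult_div_eq_mod)
      moreover have "0 \<le> \<psi> (Ej j) mod int p" "\<psi> (Ej j) mod int p < int p" "int p \<le> int p ^ 2"
        using p_ge_2 by (auto simp: power2_eq_square)
      ultimately show ?thesis
        using is_char_range[OF \<psi>(1) U1_compose[OF E1], of u] True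
        by (auto simp: cong_def)
    next
      case False
      have i1: "1 \<le> i"
        using i j by simp
      have "[\<psi> (Ej i oo u) = \<psi> (Ej i)] (mod int p ^ 2)"
        by (rule Ej_compose_cong[OF \<psi>(1) u(1,2) _ i1 dvd_refl, where n = "Suc m"])
          (use kills i False j in auto)
      then have "\<psi> (Ej i oo u) = \<psi> (Ej i)"
        by (rule is_char_eqI[OF \<psi>(1,1) U1_compose[OF Ej_in_U1[OF i1]] Ej_in_U1[OF i1]])
      then show ?thesis
        using \<psi>(5)[of i] i False by simp
    qed
    \<comment> \<open>The earlier normalisation below \<open>l\<close> survives because the
      substitution has depth greater than \<open>l\<close>.\<close>
    moreover have "int p dvd ?\<psi> (Ej i)" if i: "1 \<le> i" "i < l" for i
    proof -
      have "[\<psi> (Ej i oo u) = \<psi> (Ej i)] (mod int p)"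
        by (rule Ej_compose_cong[OF \<psi>(1) u(1,2) _ i(1), where n = "Suc l"])
          (use char_type_dvd[OF \<psi>(3)] k in auto)
      then show ?thesis
        using cong_dvd_iff \<psi>(4)[OF i] by auto
    qed
    ultimately show ?thesis
      using is_char_compose[OF \<psi>(1) u(1)] char_type_compose[OF \<psi>(1,3) u(1)]
        strict_equiv_trans[OF \<chi> \<psi>(2) strict_equiv_substI[of u \<psi>, OF u(1,3)]]
      by (intro exI[of _ ?\<psi>]) auto
  qed
qed

subsection \<open>Reduced forms\<close>

text \<open>The two contributions are kept separate since \<open>l\<close> may itself lie in the
  window from \<open>m - l\<close> to \<open>m\<close>.\<close>

lemma reduced_expansion_Ej:
  assumes "\<not> p dvd l" "1 \<le> i" "\<not> p dvd i"
  shows "x * Zfrak p l (Ej i :: 'a fps) +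
      (\<Sum>j\<in>{j. m - l \<le> j \<and> j \<le> m \<and> \<not> p dvd j}. b j * int p * Zfrak p j (Ej i :: 'a fps)) =
    (if i = l then x else 0) + (if m - l \<le> i \<and> i \<le> m then int p * b i else 0)"
proof -
  let ?J = "{j. m - l \<le> j \<and> j \<le> m \<and> \<not> p dvd j}"
  have fin: "finite ?J"
    by (rule finite_subset[of _ "{..m}"]) auto
  have "(\<Sum>j\<in>?J. b j * int p * Zfrak p j (Ej i :: 'a fps)) =
      (\<Sum>j\<in>?J. if j = i then int p * b i else 0)"
    using assms(2,3) by (intro sum.cong) (auto simp: Zfrak_Ej)
  also have "\<dots> = (if i \<in> ?J then int p * b i else 0)"
    using fin by (simp add: sum.delta)
  finally show ?thesis
    using assms by (simp add: Zfrak_Ej)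
qed

lemma reduced_form_Ej:
  fixes \<psi> :: "'a fps \<Rightarrow> int"
  assumes red: "reduced_form p l m \<psi>" and l: "\<not> p dvd l" and i: "1 \<le> i" "\<not> p dvd i"
  shows "i \<noteq> l \<Longrightarrow> int p dvd \<psi> (Ej i)"
    and "\<not> (m - l \<le> i \<and> i \<le> m) \<Longrightarrow> \<psi> (Ej i) < int p"
proof -
  obtain x b where x: "x \<in> {1..<int p}" and \<psi>: "\<forall>f\<in>U1. \<psi> f = (x * Zfrak p l f +
      (\<Sum>j\<in>{j. m - l \<le> j \<and> j \<le> m \<and> \<not> p dvd j}. b j * int p * Zfrak p j f)) mod (int p ^ 2)"
    using red unfolding reduced_form_def by blast
  have "\<psi> (Ej i) = ((if i = l then x else 0) +
      (if m - l \<le> i \<and> i \<le> m then int p * b i else 0)) mod (int p ^ 2)"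
    using \<psi>[rule_format, OF Ej_in_U1[OF i(1)]] unfolding reduced_expansion_Ej[OF l i] .
  moreover have "x mod int p ^ 2 = x"
  proof (rule mod_pos_pos_trivial)
    have "int p \<le> int p ^ 2"
      using p_ge_2 by (intro self_le_power) auto
    then show "x < int p ^ 2"
      using x unfolding atLeastLessThan_iff by linarith
  qed (use x in simp)
  ultimately show "i \<noteq> l \<Longrightarrow> int p dvd \<psi> (Ej i)"
    and "\<not> (m - l \<le> i \<and> i \<le> m) \<Longrightarrow> \<psi> (Ej i) < int p"
    using x p_ge_2 by (auto simp: dvd_mod_iff)
qed

text \<open>Each value at \<open>Ej i\<close> is split into residue and quotient by
  \<open>p\<close>: the residue survives only at \<open>l\<close>, the quotient only in the window.
  Comparison at the \<open>Ej i\<close> then suffices.\<close>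

lemma reduced_formI:
  fixes \<psi> :: "'a fps \<Rightarrow> int"
  assumes \<psi>: "is_char p \<psi>" and type: "char_type p \<psi> l m" and l: "\<not> p dvd l"
    and dvd: "\<And>i. 1 \<le> i \<Longrightarrow> i < l \<Longrightarrow> int p dvd \<psi> (Ej i)"
    and small: "\<And>i. 1 \<le> i \<Longrightarrow> i < m - l \<Longrightarrow> \<not> p dvd i \<Longrightarrow> \<psi> (Ej i) < int p"
  shows "reduced_form p l m \<psi>"
proof -
  have l1: "1 \<le> l" and m1: "1 \<le> m" and lm: "l < m"
    using char_typeD[OF type] char_type_l_less_m[OF \<psi> type] by auto
  define x where "x = \<psi> (Ej l) mod int p"
  \<comment> \<open>\<open>Ej 0\<close> is 1 + 1, which is not a principal unit, so its value is
    unrestricted; the default 0 keeps \<open>b 0\<close> in range.\<close>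
  define b where "b j = (if 1 \<le> j then \<psi> (Ej j) div int p else 0)" for j
  let ?J = "{j. m - l \<le> j \<and> j \<le> m \<and> \<not> p dvd j}"
  let ?R = "\<lambda>f::'a fps. (x * Zfrak p l f + (\<Sum>j\<in>?J. b j * int p * Zfrak p j f)) mod (int p ^ 2)"
  have p0: "0 < int p"
    using p_ge_2 by simp
  have dvd': "int p dvd \<psi> (Ej i)" if "1 \<le> i" "i \<noteq> l" for i
  proof (cases "i < l")
    case False
    then have "Ej i \<in> (Uj (Suc l) :: 'a fps set)"
      using Ej_in_Uj[OF that(1), where 'a = 'a] Uj_antimono[of "Suc l" i, where 'a = 'a] that(2)
      by auto
    then show ?thesis
      by (rule char_type_dvd[OF type])
  qed (use dvd that in auto)
  have "\<not> int p dvd \<psi> (Ej l)"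
    using not_dvd_of_leading[OF \<psi> type Ej_in_Uj[OF l1]] Ej_nth_self[OF l1, where 'a = 'a] by simp
  then have "x \<noteq> 0"
    by (simp add: x_def dvd_eq_mod_eq_0)
  moreover have "0 \<le> x" "x < int p"
    using p0 by (auto simp: x_def)
  ultimately have x: "x \<in> {1..<int p}"
    by simp
  have b: "b j \<in> {0..<int p}" for j
  proof (cases "1 \<le> j")
    case True
    have "0 \<le> \<psi> (Ej j)" "\<psi> (Ej j) < int p * int p"
      using is_char_range[OF \<psi> Ej_in_U1[OF True]] by (auto simp: power2_eq_square)
    moreover have "int p * int p \<le> int p * (\<psi> (Ej j) div int p)" if "int p \<le> \<psi> (Ej j) div int p"
      using that p0 by (intro mult_left_mono) auto
    moreover have "int p * (\<psi> (Ej j) div int p) \<le> \<psi> (Ej j)"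
      using pos_mod_sign[OF p0, of "\<psi> (Ej j)"] mult_div_mod_eq[of "int p" "\<psi> (Ej j)"] by linarith
    ultimately have "\<psi> (Ej j) div int p < int p"
      by linarith
    then show ?thesis
      using True p0 \<open>0 \<le> \<psi> (Ej j)\<close> by (simp add: b_def pos_imp_zdiv_nonneg_iff)
  qed (use p0 in \<open>simp add: b_def\<close>)
  have "b m \<noteq> 0"
  proof -
    have "\<psi> (Ej m) \<noteq> 0"
      using neq_0_of_leading[OF \<psi> type Ej_in_Uj[OF m1]] Ej_nth_self[OF m1, where 'a = 'a] by simp
    moreover have "int p dvd \<psi> (Ej m)"
      using dvd'[OF m1] lm by simp
    ultimately show ?thesis
      using m1 by (auto simp: b_def)
  qed
  moreover have "\<psi> f = ?R f" if "f \<in> U1" for f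
  proof (rule is_char_eq_on_U1I[OF \<psi> _ _ that])
    have "is_char p (\<lambda>f::'a fps. ((x * Zfrak p l f) mod int p ^ 2 +
        (\<Sum>j\<in>?J. b j * int p * Zfrak p j f) mod int p ^ 2) mod int p ^ 2)"
    proof (intro is_char_add is_char_scale is_char_sum is_char_Zfrak l)
      show "finite ?J"
        by (rule finite_subset[of _ "{..m}"]) auto
    qed (use p0 in auto)
    then show "is_char p ?R"
      by (simp add: mod_add_eq)
  next
    fix i :: nat
    assume i: "1 \<le> i" "\<not> p dvd i"
    have Ei: "0 \<le> \<psi> (Ej i)" "\<psi> (Ej i) < int p ^ 2"
      using is_char_range[OF \<psi> Ej_in_U1[OF i(1)]] by auto
    have "\<psi> (Ej i) = (if i = l then x else 0) + (if m - l \<le> i \<and> i \<le> m then int p * b i else 0)"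
    proof -
      consider "i > m" | "m - l \<le> i" "i \<le> m" | "i < m - l"
        by linarith
      then show ?thesis
      proof cases
        case 1
        then have "Ej i \<in> (Uj (Suc m) :: 'a fps set)"
          using Ej_in_Uj[OF i(1), where 'a = 'a] Uj_antimono[of "Suc m" i, where 'a = 'a] by auto
        then show ?thesis
          using char_type_eq_0[OF type] 1 lm by simp
      next
        case 2
        have "\<psi> (Ej i) mod int p + int p * (\<psi> (Ej i) div int p) = \<psi> (Ej i)"
          by simp
        moreover have "\<psi> (Ej i) mod int p = (if i = l then x else 0)"
          using dvd'[OF i(1)] by (simp add: x_def)
        ultimately show ?thesis
          using 2 i(1) by (simp add: b_def)
      next
        case 3
        have "\<psi> (Ej i) mod int p = \<psi> (Ej i)"
          using small[OF i(1) 3 i(2)] Ei by simp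
        moreover have "\<psi> (Ej i) mod int p = (if i = l then x else 0)"
          using dvd'[OF i(1)] by (simp add: x_def)
        ultimately show ?thesis
          using 3 by simp
      qed
    qed
    then show "\<psi> (Ej i) = ?R (Ej i)"
      using reduced_expansion_Ej[OF l i, of x b m] Ei by simp
  qed
  ultimately show ?thesis
    unfolding reduced_form_def using x b by blast
qed

section \<open>Uniqueness of the reduced form\<close>

text \<open>Suppose the first nonzero coefficient of w/t after the constant term is at k \<le> l.
  For k < l, E_(l-k) is multiplied by an element with leading term at \<open>l\<close>, which
  changes its value modulo \<open>p\<close>; for k = l, \<psi>(w/t) itself is prime to
  \<open>p\<close>.\<close>

lemma strict_stabilizer_depth:
  fixes \<psi> :: "'a fps \<Rightarrow> int"
  assumes \<psi>: "is_char p \<psi>" and type: "char_type p \<psi> l m" and lp: "l < p"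
    and w: "w \<in> Nottingham" "\<psi> (fps_shift 1 w) = 0"
    and dvd: "\<And>i. 1 \<le> i \<Longrightarrow> i < l \<Longrightarrow> int p dvd \<psi> (Ej i)"
    and dvd_w: "\<And>i. 1 \<le> i \<Longrightarrow> i < l \<Longrightarrow> int p dvd \<psi> (Ej i oo w)"
  shows "fps_shift 1 w \<in> Uj (Suc l)"
proof -
  let ?g = "fps_shift 1 w"
  have "?g \<in> Uj (Suc k)" if "k \<le> l" for k
    using that
  proof (induction k)
    case 0
    then show ?case
      using fps_shift_Nottingham[OF w(1)] by (simp add: U1_eq_Uj)
  next
    case (Suc k)
    then have IH: "?g \<in> Uj (Suc k)"
      by simp
    have "fps_nth ?g (Suc k) = 0"
    proof (rule ccontr)
      assume neq: "fps_nth ?g (Suc k) \<noteq> 0"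
      show False
      proof (cases "Suc k = l")
        case True
        then show False
          using not_dvd_of_leading[OF \<psi> type, of ?g] IH neq w(2) by simp
      next
        case False
        define j where "j = l - Suc k"
        have j: "1 \<le> j" "j < l" "j + Suc k = l"
          using False Suc.prems by (auto simp: j_def)
        obtain h where h: "h \<in> Uj (j + Suc k)" "Ej j oo w = Ej j * h"
          "fps_nth h (j + Suc k) = of_nat j * fps_nth ?g (Suc k)"
          using Ej_compose[OF w(1) IH _ j(1)] by auto
        have "\<not> p dvd j"
          using j lp by (auto dest: dvd_imp_le)
        then have "fps_nth h l \<noteq> 0"
          using h(3) neq of_nat_eq_0_iff_dvd[of j] j(3) by simp
        then have "\<not> int p dvd \<psi> h"
          using not_dvd_of_leading[OF \<psi> type, of h] h(1) j(3) by simp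
        moreover have "[\<psi> (Ej j oo w) = \<psi> (Ej j) + \<psi> h] (mod int p)"
          unfolding h(2)
          using is_char_mult[OF \<psi> Ej_in_U1[OF j(1)] UjD_U1[OF h(1)]]
          by (rule cong_dvd_modulus) simp
        ultimately show False
          using cong_dvd_iff dvd[OF j(1,2)] dvd_w[OF j(1,2)] by (metis dvd_add_right_iff)
      qed
    qed
    then show ?case
      using Uj_SucI[OF IH] by simp
  qed
  then show ?thesis by simp
qed

text \<open>At depth l + 1 the window values are preserved exactly. Outside the window reduced forms
  have values in [0, p), so comparing residues modulo \<open>p\<close> is enough.\<close>

lemma reduced_form_unique:
  fixes \<psi> \<psi>' :: "'a fps \<Rightarrow> int"
  assumes \<psi>: "is_char p \<psi>" "char_type p \<psi> l m" "reduced_form p l m \<psi>"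
    and \<psi>': "is_char p \<psi>'" "reduced_form p l m \<psi>'"
    and equiv: "strict_equiv \<psi> \<psi>'" and lp: "l < p" and f: "f \<in> U1"
  shows "\<psi>' f = \<psi> f"
proof -
  have l1: "1 \<le> l" and l: "\<not> p dvd l"
    using char_type_l_ge_1[OF \<psi>(2)] lp by (auto dest: dvd_imp_le)
  obtain w where w: "w \<in> Nottingham" "\<psi> (fps_shift 1 w) = 0"
    and \<psi>'_eq: "\<And>f. f \<in> U1 \<Longrightarrow> \<psi>' f = \<psi> (f oo w)"
    using equiv unfolding strict_equiv_def by blast
  have dvd: "int p dvd \<psi> (Ej i)" "int p dvd \<psi> (Ej i oo w)" if i: "1 \<le> i" "i < l" for i
  proof -
    have "\<not> p dvd i"
      using i lp by (auto dest: dvd_imp_le)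
    then show "int p dvd \<psi> (Ej i)" "int p dvd \<psi> (Ej i oo w)"
      using reduced_form_Ej(1)[OF \<psi>(3) l i(1)] reduced_form_Ej(1)[OF \<psi>'(2) l i(1)] i
        \<psi>'_eq[OF Ej_in_U1[OF i(1)]] by auto
  qed
  have depth: "fps_shift 1 w \<in> Uj (Suc l)"
    by (rule strict_stabilizer_depth[OF \<psi>(1,2) lp w dvd])
  show ?thesis
  proof (rule is_char_eq_on_U1I[OF \<psi>'(1) \<psi>(1) _ f])
    fix i :: nat
    assume i: "1 \<le> i" "\<not> p dvd i"
    have E1: "Ej i \<in> (U1 :: 'a fps set)"
      using Ej_in_U1[OF i(1)] .
    show "\<psi>' (Ej i) = \<psi> (Ej i)"
    proof (cases "m - l \<le> i \<and> i \<le> m")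
      case True
      \<comment> \<open>From i \<ge> m - l follows i + (l + 1) \<ge> m + 1: the lower end of the
        window is exactly what makes the change vanish.\<close>
      have "[\<psi> (Ej i oo w) = \<psi> (Ej i)] (mod int p ^ 2)"
        by (rule Ej_compose_cong[OF \<psi>(1) w(1) depth _ i(1), where n = "Suc m"])
          (use char_type_eq_0[OF \<psi>(2)] True in auto)
      then show ?thesis
        using is_char_eqI[OF \<psi>(1,1) U1_compose[OF E1] E1] \<psi>'_eq[OF E1] by simp
    next
      case False
      have "[\<psi>' (Ej i) = \<psi> (Ej i)] (mod int p)"
      proof (cases "i = l")
        case True
        have "[\<psi> (Ej i oo w) = \<psi> (Ej i)] (mod int p)"
          by (rule Ej_compose_cong[OF \<psi>(1) w(1) depth _ i(1), where n = "Suc l"])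
            (use char_type_dvd[OF \<psi>(2)] in auto)
        then show ?thesis
          using \<psi>'_eq[OF E1] by simp
      next
        case False
        then have "int p dvd \<psi> (Ej i)" "int p dvd \<psi>' (Ej i)"
          using reduced_form_Ej(1)[OF \<psi>(3) l i] reduced_form_Ej(1)[OF \<psi>'(2) l i] by auto
        then show ?thesis
          by (simp add: cong_def dvd_eq_mod_eq_0)
      qed
      then show ?thesis
        using reduced_form_Ej(2)[OF \<psi>(3) l i False] reduced_form_Ej(2)[OF \<psi>'(2) l i False]
          is_char_range[OF \<psi>(1) E1] is_char_range[OF \<psi>'(1) E1]
        by (intro cong_less_imp_eq_int[of _ "int p"]) auto
    qed
  qed
qed

end

theorem theorem1p2:
  fixes \<chi> :: "'a::{field,finite} fps \<Rightarrow> int" and p l m :: nat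
  assumes "p = card (UNIV :: 'a set)" and "prime p" and "l < p"
    and "surj_char p \<chi>" and "char_type p \<chi> l m"
  shows "\<exists>\<psi>::'a fps \<Rightarrow> int. is_char p \<psi> \<and> reduced_form p l m \<psi> \<and> strict_equiv \<chi> \<psi> \<and>
           (\<forall>\<psi>'::'a fps \<Rightarrow> int. is_char p \<psi>' \<and> reduced_form p l m \<psi>' \<and> strict_equiv \<chi> \<psi>'
              \<longrightarrow> (\<forall>f\<in>U1. \<psi>' f = \<psi> f))"
proof -
  interpret prime_order_field p "TYPE('a)"
    using assms(1,2) by unfold_locales
  have \<chi>: "is_char p \<chi>"
    using assms(4) by (simp add: surj_char_def)
  have l: "\<not> p dvd l"
    using char_type_l_ge_1[OF assms(5)] assms(3) by (auto dest: dvd_imp_le)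
  \<comment> \<open>The descent that clears the coefficients below the window runs from
    \<open>m - l\<close> down to 1.\<close>
  have "1 \<le> m - l"
    using char_type_l_less_m[OF \<chi> assms(5)] by simp
  then obtain \<psi> where \<psi>: "is_char p \<psi>" "strict_equiv \<chi> \<psi>" "char_type p \<psi> l m"
    "\<And>i. 1 \<le> i \<Longrightarrow> i < l \<Longrightarrow> int p dvd \<psi> (Ej i)"
    "\<And>i. 1 \<le> i \<Longrightarrow> i < m - l \<Longrightarrow> \<not> p dvd i \<Longrightarrow> \<psi> (Ej i) < int p"
    using exists_equiv_small_below_window[OF \<chi> assms(5,3), of 1] by auto
  have red: "reduced_form p l m \<psi>"
    using reduced_formI[OF \<psi>(1,3) l \<psi>(4,5)] .
  \<comment> \<open>Both forms are equivalent to \<chi>, hence to each other by symmetry and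
    transitivity.\<close>
  have "\<psi>' f = \<psi> f" if "is_char p \<psi>'" "reduced_form p l m \<psi>'" "strict_equiv \<chi> \<psi>'" "f \<in> U1" for \<psi>' f
    using reduced_form_unique[OF \<psi>(1,3) red that(1,2) _ assms(3) that(4)]
      strict_equiv_trans[OF \<psi>(1) strict_equiv_sym[OF \<chi> \<psi>(2)] that(3)] .
  then show ?thesis
    using \<psi>(1,2) red by blast
qed

end
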